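(* Let $\mu,\alpha\in\mathbb{R}^d$, let $\Sigma\in\mathbb{R}^{d\times d}$ be symmetric positive definite, let $q(w)$ be a probability distribution of a scalar variable $w$ that does not depend on $(\mu,\alpha,\Sigma)$, and let $u,v$ be real-valued functions of $w$ with $v(w)>0$. Let $$q(w,z)=q(w,z\mid\mu,\alpha,\Sigma):=\mathcal{N}\big(z\mid \mu+u(w)\alpha,\;v(w)\Sigma\big)\,q(w),\qquad q(z)=q(z\mid\mu,\alpha,\Sigma):=\int q(w,z\mid\mu,\alpha,\Sigma)\,dw.$$ Let $h:\mathbb{R}^d\to\mathbb{R}$ be continuously differentiable with $\nabla_z h$ locally ACL, and suppose $\mathbb{E}_{q(w,z)}[v(w)h(z)]$ is well-defined. Assume moreover that the expectations $\mathbb{E}_{q(z)}[h(z)]$, $\mathbb{E}_{q(w,z)}[v(w)\nabla_z^2h(z)]$, $\mathbb{E}_{q(w,z)}[\Sigma^{-1}(z-\mu-u(w)\alpha)\nabla_z^Th(z)]$ and $\mathbb{E}_{q(w,z)}\big[h(z)\frac{\nabla_{\Sigma}q(w,z)}{q(w,z)}\big]$ are well-defined and that differentiation and integration may be interchanged, i.e. $\nabla_{\Sigma}\mathbb{E}_{q(z)}[h(z)]=\mathbb{E}_{q(w,z)}\big[h(z)\frac{\nabla_{\Sigma}q(w,z)}{q(w,z)}\big]$. Then $$\nabla_{\Sigma}\mathbb{E}_{q(z)}[h(z)]=\tfrac12\,\mathbb{E}_{q(w,z)}\big[v(w)\nabla_z^2h(z)\big]=\tfrac12\,\mathbb{E}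_{q(w,z)}\big[\Sigma^{-1}(z-\mu-u(w)\alpha)\nabla_z^Th(z)\big].$$
   Context: $\mathcal{N}(z\mid m,S)$ is the density of the Gaussian distribution with mean $m$ and covariance $S$. An expectation $\mathbb{E}_q[g]$ is called well-defined if $\mathbb{E}_q[\|g\|]<\infty$ (Euclidean norm; Frobenius norm for matrices). A function $g:[a,b]\to\mathbb{R}^m$ is absolutely continuous (AC) if its derivative exists almost everywhere on $[a,b]$, is Lebesgue integrable, and $g(x)=g(a)+\int_a^x g'(t)\,dt$ for all $x\in[a,b]$. A function $g:\mathbb{R}\to\mathbb{R}^m$ is locally AC if it is AC on every compact interval. A function $g:\mathbb{R}^d\to\mathbb{R}^m$ is locally ACL if for every $i$ and almost every $z_{-i}\in\mathbb{R}^{d-1}$ (all coordinates except the $i$-th), the function $z_i\mapsto g(z_i,z_{-i})$ is locally AC; its partial derivatives then exist almost everywhere. $\nabla_z h$ is the gradient as a column vector, $\nabla_z^Th$ its transpose, and $\nabla_z^2h$ the matrix of second partial derivatives (existing almost everywhere). $\nabla_\Sigma F$ denotes the symmetric matrix $G$ such that the derivative of $F$ at $\Sigma$ in each symmetric direction $H$ is $\mathrm{tr}(GH)$; with this convention $\nabla_\Sigma\mathcal{N}(z\mid\mu,\Sigma)=\frac12\Sigma^{-1}[(z-\mu)(z-\mu)^T-\Sigma]\Sigma^{-1}\mathcal{N}(z\mid\mu,\Sigma)$. *)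

theory Defs
  imports "HOL-Probability.Probability"
begin

definition abs_cont_on :: "real \<Rightarrow> real \<Rightarrow> (real \<Rightarrow> 'a::euclidean_space) \<Rightarrow> bool" where
  "abs_cont_on a b g \<longleftrightarrow>
     (\<exists>g'. (AE x in lebesgue. x \<in> {a..b} \<longrightarrow> (g has_vector_derivative g' x) (at x within {a..b})) \<and>
           set_integrable lebesgue {a..b} g' \<and>
           (\<forall>x\<in>{a..b}. g x = g a + set_lebesgue_integral lebesgue {a..x} g'))"

definition locally_abs_cont :: "(real \<Rightarrow> 'a::euclidean_space) \<Rightarrow> bool" where
  "locally_abs_cont g \<longleftrightarrow> (\<forall>a b. a \<le> b \<longrightarrow> abs_cont_on a b g)"

text \<open>The remaining coordinates range over the product of one copy of the real line for each
  index other than \<open>i\<close>. In dimension one this product is a single point of mass one, so the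
  condition is then just local absolute continuity.\<close>

definition locally_ACL :: "(real^'n \<Rightarrow> 'a::euclidean_space) \<Rightarrow> bool" where
  "locally_ACL g \<longleftrightarrow>
     (\<forall>i. AE y in (\<Pi>\<^sub>M k\<in>UNIV - {i}. lborel).
            locally_abs_cont (\<lambda>t. g (\<chi> k. if k = i then t else y k)))"

text \<open>Where the derivative does not exist, \<^const>\<open>deriv\<close> returns one fixed unspecified number.
  For the second derivatives of a continuously differentiable function with locally ACL gradient
  this affects a Borel null set only.\<close>

definition partial_deriv :: "'n \<Rightarrow> (real^'n \<Rightarrow> real) \<Rightarrow> real^'n \<Rightarrow> real" where
  "partial_deriv i f z = deriv (\<lambda>t. f (z + t *\<^sub>R axis i 1)) 0"

definition grad :: "(real^'n \<Rightarrow> real) \<Rightarrow> real^'n \<Rightarrow> real^'n" where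
  "grad f z = (\<chi> j. partial_deriv j f z)"

definition hess :: "(real^'n \<Rightarrow> real) \<Rightarrow> real^'n \<Rightarrow> real^'n^'n" where
  "hess f z = (\<chi> i j. partial_deriv i (partial_deriv j f) z)"

definition cont_differentiable :: "(real^'n \<Rightarrow> real) \<Rightarrow> bool" where
  "cont_differentiable f \<longleftrightarrow> (\<forall>z. f differentiable (at z)) \<and> continuous_on UNIV (grad f)"

definition pos_def :: "real^'n^'n \<Rightarrow> bool" where
  "pos_def S \<longleftrightarrow> (\<forall>x. x \<noteq> 0 \<longrightarrow> 0 < x \<bullet> (S *v x))"

definition outer_prod :: "real^'m \<Rightarrow> real^'n \<Rightarrow> real^'n^'m" where
  "outer_prod x y = (\<chi> i j. x $ i * y $ j)"

definition has_sym_gradient :: "(real^'n^'n \<Rightarrow> real) \<Rightarrow> real^'n^'n \<Rightarrow> real^'n^'n \<Rightarrow> bool" where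
  "has_sym_gradient F G S \<longleftrightarrow> transpose G = G \<and>
     (\<forall>H. transpose H = H \<longrightarrow>
        ((\<lambda>t. F (S + t *\<^sub>R H)) has_real_derivative trace (G ** H)) (at 0))"

definition sym_gradient :: "(real^'n^'n \<Rightarrow> real) \<Rightarrow> real^'n^'n \<Rightarrow> real^'n^'n" where
  "sym_gradient F S = (THE G. has_sym_gradient F G S)"

lemma has_sym_gradient_unique:
  assumes "has_sym_gradient F G S" "has_sym_gradient F G' S"
  shows "G = G'"
proof -
  define D where "D = G - G'"
  have sym: "transpose D = D"
    using assms by (simp add: D_def has_sym_gradient_def transpose_def vec_eq_iff)
  have "trace (G ** D) = trace (G' ** D)"
    using assms sym unfolding has_sym_gradient_def by (blast intro: DERIV_unique)
  hence "0 = trace (D ** D)"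
    by (simp add: D_def trace_def matrix_matrix_mult_def left_diff_distrib sum_subtractf)
  also have "\<dots> = (\<Sum>i\<in>UNIV. \<Sum>j\<in>UNIV. D $ i $ j * transpose D $ i $ j)"
    unfolding trace_def matrix_matrix_mult_def by (simp add: transpose_def)
  also have "\<dots> = D \<bullet> D"
    unfolding sym by (simp add: inner_vec_def)
  finally show ?thesis
    by (simp add: D_def)
qed

lemma sym_gradient_eqI: "has_sym_gradient F G S \<Longrightarrow> sym_gradient F S = G"
  unfolding sym_gradient_def by (blast intro: has_sym_gradient_unique)

definition gauss_density :: "real^'n \<Rightarrow> real^'n^'n \<Rightarrow> real^'n \<Rightarrow> real" where
  "gauss_density m S z =
     exp (- (1 / 2) * ((z - m) \<bullet> (matrix_inv S *v (z - m)))) / sqrt ((2 * pi) ^ CARD('n) * det S)"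

text \<open>The law of \<open>w\<close> is an arbitrary measure \<open>q\<close> on the real line, not necessarily one with a
  Lebesgue density. Accordingly the joint density is taken relative to the product of \<open>q\<close> and
  Lebesgue measure, which absorbs the factor \<open>q(w)\<close>. As that factor does not depend on the
  covariance parameter, it cancels in the quotient of the gradient of the joint density by the
  joint density.\<close>

definition mix_density ::
  "(real \<Rightarrow> real) \<Rightarrow> (real \<Rightarrow> real) \<Rightarrow> real^'n \<Rightarrow> real^'n \<Rightarrow> real^'n^'n \<Rightarrow> real \<Rightarrow> real^'n \<Rightarrow> real" where
  "mix_density u v \<mu> \<alpha> S w z = gauss_density (\<mu> + u w *\<^sub>R \<alpha>) (v w *\<^sub>R S) z"

definition mix_joint ::
  "real measure \<Rightarrow> (real \<Rightarrow> real) \<Rightarrow> (real \<Rightarrow> real) \<Rightarrow> real^'n \<Rightarrow> real^'n \<Rightarrow> real^'n^'n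
     \<Rightarrow> (real \<times> (real^'n)) measure" where
  "mix_joint q u v \<mu> \<alpha> S =
     density (q \<Otimes>\<^sub>M lborel) (\<lambda>(w, z). ennreal (mix_density u v \<mu> \<alpha> S w z))"

definition mix_marginal ::
  "real measure \<Rightarrow> (real \<Rightarrow> real) \<Rightarrow> (real \<Rightarrow> real) \<Rightarrow> real^'n \<Rightarrow> real^'n \<Rightarrow> real^'n^'n
     \<Rightarrow> (real^'n) measure" where
  "mix_marginal q u v \<mu> \<alpha> S =
     density lborel (\<lambda>z. \<integral>\<^sup>+ w. ennreal (mix_density u v \<mu> \<alpha> S w z) \<partial>q)"

end

theory Submission
  imports Defs "HOL-Real_Asymp.Real_Asymp"
begin

text \<open>Write \<open>p\<close> for the Gaussian density with mean \<open>m\<close> and covariance \<open>c \<cdot> S\<close>, and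
  \<open>a(z) = S\<inverse>(z - m)\<close>, so that the partial derivative of \<open>p\<close> in \<open>z\<^sub>i\<close> is \<open>- a\<^sub>i p / c\<close> and the
  score in \<open>S\<close> has entries \<open>(a\<^sub>i a\<^sub>j / c - S\<inverse>\<^sub>i\<^sub>j) / 2\<close>. For almost every \<open>w\<close> both equalities come
  from integrating by parts along coordinate lines: the derivative of \<open>p \<cdot> \<partial>\<^sub>jh\<close> along \<open>z\<^sub>i\<close> links the
  Hessian term to the gradient term, and the derivative of \<open>p \<cdot> h \<cdot> a\<^sub>i\<close> along \<open>z\<^sub>j\<close> links the gradient
  term to the score term.

  No decay is assumed, so the boundary terms need an argument. They converge, because the
  derivative is integrable on almost every line, and a nonzero limit would contradict the
  integrability of a dominating function: \<open>p \<cdot> a\<^sub>i \<cdot> \<partial>\<^sub>jh\<close> in the first case, since \<open>a\<^sub>i\<close> has slope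
  \<open>S\<inverse>\<^sub>i\<^sub>i > 0\<close> along the line, and the \<open>(j, j)\<close> entry of the score integrand, which is quadratic
  in \<open>z\<^sub>j\<close>, in the second.\<close>

section \<open>Integration by parts on the line\<close>

text \<open>A nonzero limit would keep \<open>\<bar>g\<bar>\<close> at least
  \<open>\<bar>L\<bar> / 2\<close> on a half-line, whose infinite measure rules out
  integrability.\<close>

lemma limit_eq_0_of_integrable_bound:
  fixes f g :: "real \<Rightarrow> real"
  assumes lim: "(f \<longlongrightarrow> L) at_top"
    and int: "integrable lborel g"
    and bound: "eventually (\<lambda>t. \<bar>f t\<bar> \<le> \<bar>g t\<bar>) at_top"
  shows "L = 0"
proof (rule ccontr)
  assume "L \<noteq> 0"
  have "eventually (\<lambda>t. \<bar>L\<bar> / 2 < \<bar>f t\<bar>) at_top"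
    using tendsto_rabs[OF lim] \<open>L \<noteq> 0\<close> by (intro order_tendstoD(1)) auto
  with bound have "eventually (\<lambda>t. \<bar>L\<bar> / 2 \<le> \<bar>g t\<bar>) at_top"
    by eventually_elim auto
  then obtain N where N: "\<And>t. N \<le> t \<Longrightarrow> \<bar>L\<bar> / 2 \<le> \<bar>g t\<bar>"
    by (auto simp: eventually_at_top_linorder)
  have "integrable lborel (\<lambda>t. indicator {N..} t * (\<bar>L\<bar> / 2) :: real)"
  proof (rule Bochner_Integration.integrable_bound[OF int])
    show "AE t in lborel. norm (indicator {N..} t * (\<bar>L\<bar> / 2)) \<le> norm (g t)"
      using N by (intro AE_I2) (simp split: split_indicator)
  qed measurable
  \<comment> \<open>Scaling the constant away leaves a plain indicator, so that integrability
    becomes finiteness of a measure.\<close>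
  hence "integrable lborel (\<lambda>t. indicator {N..} t * (\<bar>L\<bar> / 2) * (2 / \<bar>L\<bar>) :: real)"
    by (rule integrable_mult_left)
  moreover have "(\<lambda>t. indicator {N..} t * (\<bar>L\<bar> / 2) * (2 / \<bar>L\<bar>)) = (indicator {N..} :: real \<Rightarrow> real)"
    using \<open>L \<noteq> 0\<close> by auto
  ultimately have "emeasure lborel {N..} < \<infinity>"
    by (simp add: integrable_indicator_iff)
  moreover have "ennreal r \<le> emeasure lborel {N..}" if "0 \<le> r" for r
  proof -
    have "ennreal r = emeasure lborel {N..N + r}"
      using that by simp
    also have "\<dots> \<le> emeasure lborel {N..}"
      by (intro emeasure_mono) auto
    finally show ?thesis .
  qed
  ultimately show False
    by (metis ennreal_enn2real enn2real_nonneg linorder_not_le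
        ennreal_less_iff less_add_one add_increasing2 zero_le_one infinity_ennreal_def)
qed

text \<open>Only the increment formula ties \<open>\<phi>'\<close> to \<open>\<phi>\<close>, so an
  almost everywhere derivative is enough. Integrability of \<open>\<phi>'\<close> gives
  \<open>\<phi>\<close> a limit at each end; the two limits differ by the total integral, and
  domination by \<open>g\<close> makes both zero.\<close>

lemma integral_derivative_eq_0:
  fixes \<phi> \<phi>' g :: "real \<Rightarrow> real"
  assumes ftc: "\<And>a b. a \<le> b \<Longrightarrow> \<phi> b - \<phi> a = (LBINT t:{a..b}. \<phi>' t)"
    and int': "integrable lborel \<phi>'"
    and int: "integrable lborel g"
    and top: "eventually (\<lambda>t. \<bar>\<phi> t\<bar> \<le> \<bar>g t\<bar>) at_top"
    and bot: "eventually (\<lambda>t. \<bar>\<phi> t\<bar> \<le> \<bar>g t\<bar>) at_bot"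
  shows "integral\<^sup>L lborel \<phi>' = 0"
proof -
  define L where "L = \<phi> 0 + (LBINT t:{0..}. \<phi>' t)"
  have "((\<lambda>x. \<phi> 0 + (LBINT t:{0..x}. \<phi>' t)) \<longlongrightarrow> L) at_top"
    unfolding L_def
    by (intro tendsto_intros tendsto_set_lebesgue_integral_at_top)
      (use integrable_mult_indicator[OF _ int', of "{0..}"] in \<open>auto simp: set_integrable_def\<close>)
  moreover have "eventually (\<lambda>x. \<phi> 0 + (LBINT t:{0..x}. \<phi>' t) = \<phi> x) at_top"
    using eventually_ge_at_top[of 0] by eventually_elim (use ftc in \<open>simp flip: ftc\<close>)
  ultimately have lim: "(\<phi> \<longlongrightarrow> L) at_top"
    by (rule Lim_transform_eventually)
  have lim_int: "((\<lambda>x. LBINT t:{-x..x}. \<phi>' t) \<longlongrightarrow> integral\<^sup>L lborel \<phi>') at_top"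
    unfolding set_lebesgue_integral_def
  proof (rule integral_dominated_convergence_at_top)
    show "integrable lborel (\<lambda>t. \<bar>\<phi>' t\<bar>)"
      using int' by simp
    show "AE t in lborel. ((\<lambda>x. indicator {- x..x} t *\<^sub>R \<phi>' t) \<longlongrightarrow> \<phi>' t) at_top"
    proof (rule AE_I2)
      fix t
      have "eventually (\<lambda>x. \<phi>' t = indicator {- x..x} t *\<^sub>R \<phi>' t) at_top"
        using eventually_ge_at_top[of "\<bar>t\<bar>"] by eventually_elim (auto simp: indicator_def)
      thus "((\<lambda>x. indicator {- x..x} t *\<^sub>R \<phi>' t) \<longlongrightarrow> \<phi>' t) at_top"
        by (rule Lim_transform_eventually[OF tendsto_const])
    qed
  qed (use int' in \<open>auto split: split_indicator intro!: always_eventually\<close>)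
  \<comment> \<open>Increments over \<open>{-x..x}\<close> yield the limit at minus infinity from
    the one at plus infinity.\<close>
  have "((\<lambda>x. \<phi> x - (LBINT t:{-x..x}. \<phi>' t)) \<longlongrightarrow> L - integral\<^sup>L lborel \<phi>') at_top"
    by (intro tendsto_intros lim lim_int)
  moreover have "eventually (\<lambda>x. \<phi> x - (LBINT t:{-x..x}. \<phi>' t) = \<phi> (- x)) at_top"
    using eventually_ge_at_top[of 0] by eventually_elim (simp flip: ftc)
  ultimately have lim': "((\<lambda>x. \<phi> (- x)) \<longlongrightarrow> L - integral\<^sup>L lborel \<phi>') at_top"
    by (rule Lim_transform_eventually)
  have "L = 0"
    using lim int top by (rule limit_eq_0_of_integrable_bound)
  moreover have "L - integral\<^sup>L lborel \<phi>' = 0"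
    using lim'
  proof (rule limit_eq_0_of_integrable_bound)
    \<comment> \<open>Reflection turns the left end into a right end.\<close>
    show "integrable lborel (\<lambda>t. g (- t))"
      using lborel_integrable_real_affine[OF int, of "-1" 0] by simp
    show "\<forall>\<^sub>F t in at_top. \<bar>\<phi> (- t)\<bar> \<le> \<bar>g (- t)\<bar>"
      using bot by (simp add: at_bot_mirror eventually_filtermap)
  qed
  ultimately show ?thesis by simp
qed

section \<open>Absolutely continuous functions on an interval\<close>

lemma abs_cont_on_bounded_linear:
  fixes f :: "real \<Rightarrow> 'a::euclidean_space" and T :: "'a \<Rightarrow> 'b::euclidean_space"
  assumes f: "abs_cont_on a b f" and T: "bounded_linear T"
  shows "abs_cont_on a b (\<lambda>t. T (f t))"
proof -
  interpret T: bounded_linear T by (rule T)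
  obtain g' where g': "AE x in lebesgue. x \<in> {a..b} \<longrightarrow> (f has_vector_derivative g' x) (at x within {a..b})"
    "set_integrable lebesgue {a..b} g'"
    "\<And>x. x \<in> {a..b} \<Longrightarrow> f x = f a + set_lebesgue_integral lebesgue {a..x} g'"
    using f unfolding abs_cont_on_def by blast
  have sub: "set_integrable lebesgue {a..x} g'" if "x \<in> {a..b}" for x
    using g'(2) by (rule set_integrable_subset) (use that in auto)
  show ?thesis
    unfolding abs_cont_on_def
  proof (intro exI[of _ "\<lambda>t. T (g' t)"] conjI ballI)
    show "AE x in lebesgue. x \<in> {a..b} \<longrightarrow> ((\<lambda>t. T (f t)) has_vector_derivative T (g' x)) (at x within {a..b})"
      using g'(1) by eventually_elim (auto intro: T.has_vector_derivative)
    show "set_integrable lebesgue {a..b} (\<lambda>t. T (g' t))"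
      using integrable_bounded_linear[OF T g'(2)[unfolded set_integrable_def]]
      by (simp add: set_integrable_def T.scaleR)
    fix x assume x: "x \<in> {a..b}"
    have "set_lebesgue_integral lebesgue {a..x} (\<lambda>t. T (g' t)) = T (set_lebesgue_integral lebesgue {a..x} g')"
      using integral_bounded_linear[OF T sub[OF x, unfolded set_integrable_def]]
      by (simp add: set_lebesgue_integral_def T.scaleR)
    thus "T (f x) = T (f a) + set_lebesgue_integral lebesgue {a..x} (\<lambda>t. T (g' t))"
      using g'(3)[OF x] by (simp add: T.add)
  qed
qed

text \<open>Absolute continuity is stated for completed Lebesgue measure, whereas Fubini is applied
  to \<open>lborel\<close>. A Lebesgue measurable function agrees almost everywhere with a Borel
  one, which provides \<open>G\<close>; at interior points the derivative within the interval is a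
  full derivative.\<close>

lemma abs_cont_on_borel_derivative:
  fixes f :: "real \<Rightarrow> real"
  assumes f: "abs_cont_on a b f"
  obtains G where "integrable lborel G"
    "AE x in lborel. a < x \<and> x < b \<longrightarrow> (f has_real_derivative G x) (at x)"
    "\<And>x. x \<in> {a..b} \<Longrightarrow> f x = f a + (LBINT t:{a..x}. G t)"
proof -
  obtain g' where g': "AE x in lebesgue. x \<in> {a..b} \<longrightarrow> (f has_vector_derivative g' x) (at x within {a..b})"
    "set_integrable lebesgue {a..b} g'"
    "\<And>x. x \<in> {a..b} \<Longrightarrow> f x = f a + set_lebesgue_integral lebesgue {a..x} g'"
    using f unfolding abs_cont_on_def by blast
  have int: "integrable lebesgue (\<lambda>t. indicator {a..b} t * g' t)"
    using g'(2) by (simp add: set_integrable_def)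
  obtain G where G[measurable]: "G \<in> borel_measurable lborel"
    and AE: "AE x in lborel. indicator {a..b} x * g' x = G x"
    using completion_ex_borel_measurable_real[OF borel_measurable_integrable[OF int]] by blast
  note AE' = AE_completion[OF AE]
  have G': "G \<in> borel_measurable lebesgue"
    using G by (rule measurable_completion)
  have "integrable lebesgue G"
    using integrable_cong_AE[OF borel_measurable_integrable[OF int] G' AE'] int by simp
  show thesis
  proof
    show "integrable lborel G"
      using \<open>integrable lebesgue G\<close> G by (simp add: integrable_completion)
    have "AE x in lborel. x \<in> {a..b} \<longrightarrow> (f has_vector_derivative g' x) (at x within {a..b})"
      using g'(1) by (simp add: AE_completion_iff)
    with AE show "AE x in lborel. a < x \<and> x < b \<longrightarrow> (f has_real_derivative G x) (at x)"
    proof eventually_elim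
      case (elim x)
      show ?case
      proof
        assume x: "a < x \<and> x < b"
        hence "at x within {a..b} = at x"
          by (intro at_within_interior) auto
        thus "(f has_real_derivative G x) (at x)"
          using elim x by (auto simp: has_real_derivative_iff_has_vector_derivative)
      qed
    qed
    fix x assume x: "x \<in> {a..b}"
    have "set_lebesgue_integral lebesgue {a..x} g' = set_lebesgue_integral lebesgue {a..x} G"
      unfolding set_lebesgue_integral_def
    proof (rule integral_cong_AE)
      \<comment> \<open>Inserting the indicator of the larger interval reduces measurability to the
        integrability fact \<open>int\<close>.\<close>
      have eq: "indicator {a..x} t *\<^sub>R g' t = indicator {a..x} t * (indicator {a..b} t * g' t)" for t :: real
        using x by (auto split: split_indicator)
      show "(\<lambda>t. indicator {a..x} t *\<^sub>R g' t) \<in> borel_measurable lebesgue"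
        unfolding eq
        by (rule borel_measurable_times[OF borel_measurable_indicator borel_measurable_integrable[OF int]]) auto
      show "(\<lambda>t. indicator {a..x} t *\<^sub>R G t) \<in> borel_measurable lebesgue"
        unfolding real_scaleR_def by (rule borel_measurable_times[OF borel_measurable_indicator G']) auto
      show "AE t in lebesgue. indicator {a..x} t *\<^sub>R g' t = indicator {a..x} t *\<^sub>R G t"
        using AE' unfolding eq by eventually_elim auto
    qed
    also have "\<dots> = (LBINT t:{a..x}. G t)"
      unfolding set_lebesgue_integral_def by (rule integral_completion) measurable
    finally show "f x = f a + (LBINT t:{a..x}. G t)"
      using g'(3)[OF x] by simp
  qed
qed

text \<open>Increments of \<open>f\<close> and \<open>p\<close> are written as integrals of
  \<open>G\<close> and \<open>p'\<close>, and Fubini is applied on a triangle in place of a product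
  rule. The formula uses \<open>deriv f\<close> because that is what \<open>partial_deriv\<close>
  becomes on a coordinate line; measurability of the integrand is therefore assumed.\<close>

lemma abs_cont_on_by_parts:
  fixes f p p' :: "real \<Rightarrow> real"
  assumes f: "abs_cont_on a b f" and "a \<le> b"
    and p: "\<And>t. (p has_real_derivative p' t) (at t)"
    and p': "continuous_on UNIV p'"
    and meas: "(\<lambda>t. deriv f t * p t + f t * p' t) \<in> borel_measurable borel"
  shows "f b * p b - f a * p a = (LBINT t:{a..b}. deriv f t * p t + f t * p' t)"
proof -
  obtain G where G: "integrable lborel G"
    and AE: "AE x in lborel. a < x \<and> x < b \<longrightarrow> (f has_real_derivative G x) (at x)"
    and f_eq: "\<And>x. x \<in> {a..b} \<Longrightarrow> f x = f a + (LBINT t:{a..x}. G t)"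
    using abs_cont_on_borel_derivative[OF f] by blast
  define G0 where "G0 t = indicator {a..b} t * G t" for t
  define P where "P t = indicator {a..b} t * p' t" for t
  have [measurable]: "G \<in> borel_measurable borel"
    using borel_measurable_integrable[OF G] by simp
  have [measurable]: "p' \<in> borel_measurable borel"
    using p' by (rule borel_measurable_continuous_onI)
  have cont_p: "continuous_on UNIV p"
    by (rule DERIV_continuous_on[OF has_field_derivative_at_within[OF p]])
  hence [measurable]: "p \<in> borel_measurable borel"
    by (rule borel_measurable_continuous_onI)
  have G0: "integrable lborel G0"
    unfolding G0_def using integrable_mult_indicator[OF _ G, of "{a..b}"] by simp
  have P: "integrable lborel P"
    unfolding P_def using borel_integrable_atLeastAtMost'[of a b p'] continuous_on_subset[OF p']
    by (simp add: set_integrable_def)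
  have int_p': "(LBINT s. indicator {c..d} s * p' s) = p d - p c" if "c \<le> d" for c d
    using integral_FTC_atLeastAtMost[OF that, of p p'] p continuous_on_subset[OF p']
    by (auto simp: has_real_derivative_iff_has_vector_derivative intro: has_vector_derivative_at_within)
  \<comment> \<open>The kernel lives on \<open>a \<le> r \<le> s \<le> b\<close>. Up to the
    remaining factor, integrating out \<open>r\<close> produces \<open>f s - f a\<close>, and
    integrating out \<open>s\<close> produces \<open>p b - p r\<close>.\<close>
  define K where "K r s = indicator {(r, s). r \<le> s} (r, s) * (G0 r * P s)" for r s :: real
  have K: "integrable (lborel \<Otimes>\<^sub>M lborel) (case_prod K)"
  proof (rule Bochner_Integration.integrable_bound)
    show "integrable (lborel \<Otimes>\<^sub>M lborel) (\<lambda>(r, s). G0 r * P s)"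
      using G0 P by (intro lborel_pair.Fubini_integrable) (auto simp: abs_mult)
    show "case_prod K \<in> borel_measurable (lborel \<Otimes>\<^sub>M lborel)"
      unfolding K_def G0_def P_def by measurable
  qed (auto simp: K_def split: split_indicator)
  have pG: "integrable lborel (\<lambda>t. G0 t * p t)"
  proof -
    have "bounded (p ` {a..b})"
      using continuous_on_subset[OF cont_p] by (intro compact_imp_bounded compact_continuous_image) auto
    then obtain B where "\<forall>y \<in> p ` {a..b}. norm y \<le> B"
      unfolding bounded_iff by blast
    hence B: "\<bar>p t\<bar> \<le> B" if "t \<in> {a..b}" for t
      using that by simp
    show ?thesis
    proof (rule Bochner_Integration.integrable_bound)
      show "integrable lborel (\<lambda>t. B * G0 t)"
        using G0 by simp
      show "AE t in lborel. norm (G0 t * p t) \<le> norm (B * G0 t)"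
      proof (intro AE_I2)
        fix t
        show "norm (G0 t * p t) \<le> norm (B * G0 t)"
          using mult_right_mono[OF order_trans[OF B abs_ge_self], of t "\<bar>G t\<bar>"]
          by (simp add: G0_def abs_mult mult.commute split: split_indicator)
      qed
      show "(\<lambda>t. G0 t * p t) \<in> borel_measurable lborel"
        unfolding G0_def by measurable
    qed
  qed
  have f_P: "P s * f s = f a * P s + (LBINT r. K r s)" for s
  proof (cases "s \<in> {a..b}")
    case True
    have "(LBINT r. K r s) = (LBINT r. P s * (indicator {a..s} r * G r))"
      using True by (intro Bochner_Integration.integral_cong) (auto simp: K_def G0_def split: split_indicator)
    also have "\<dots> = P s * (f s - f a)"
      using f_eq[OF True] by (simp add: set_lebesgue_integral_def)
    finally show ?thesis by (simp add: algebra_simps)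
  qed (simp add: P_def K_def)
  have Kr: "(LBINT s. K r s) = p b * G0 r - G0 r * p r" for r
  proof (cases "r \<in> {a..b}")
    case True
    have "(LBINT s. K r s) = (LBINT s. G0 r * (indicator {r..b} s * p' s))"
      using True by (intro Bochner_Integration.integral_cong) (auto simp: K_def P_def split: split_indicator)
    also have "\<dots> = G0 r * (p b - p r)"
      using True by (simp add: int_p')
    finally show ?thesis by (simp add: algebra_simps)
  qed (simp add: G0_def K_def)
  have int_K: "integrable lborel (\<lambda>s. LBINT r. K r s)"
    using lborel_pair.integrable_snd[OF K] .
  have Pf: "integrable lborel (\<lambda>s. P s * f s)"
    unfolding f_P using P int_K by simp
  have "(LBINT s. P s * f s) = f a * (p b - p a) + (LBINT s. LBINT r. K r s)"
  proof -
    have "(LBINT s. P s) = p b - p a"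
      unfolding P_def by (rule int_p'[OF \<open>a \<le> b\<close>])
    thus ?thesis
      unfolding f_P using P int_K by simp
  qed
  also have "(LBINT s. LBINT r. K r s) = (LBINT r. LBINT s. K r s)"
    by (rule lborel_pair.Fubini_integral[OF K])
  also have "\<dots> = p b * (LBINT r. G0 r) - (LBINT r. G0 r * p r)"
    unfolding Kr using G0 pG by simp
  also have "(LBINT r. G0 r) = f b - f a"
    using f_eq[of b] \<open>a \<le> b\<close> by (simp add: set_lebesgue_integral_def G0_def)
  finally have "f b * p b - f a * p a = (LBINT t. G0 t * p t + P t * f t)"
    using pG Pf by (simp add: algebra_simps)
  also have "\<dots> = (LBINT t:{a..b}. deriv f t * p t + f t * p' t)"
    unfolding set_lebesgue_integral_def
  proof (rule integral_cong_AE)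
    \<comment> \<open>The derivative of \<open>f\<close> is controlled only inside the interval, so
      the endpoints are discarded as null sets.\<close>
    have "AE t in lborel. t \<noteq> a" "AE t in lborel. t \<noteq> b"
      by (auto intro: AE_lborel_singleton)
    with AE show "AE t in lborel. G0 t * p t + P t * f t = indicator {a..b} t *\<^sub>R (deriv f t * p t + f t * p' t)"
      by eventually_elim (auto simp: G0_def P_def DERIV_imp_deriv split: split_indicator)
  qed (use pG Pf meas in measurable)
  finally show ?thesis .
qed

section \<open>Slicing Lebesgue measure along a coordinate\<close>

text \<open>This is the parametrisation that occurs in \<open>locally_ACL\<close>; the value of
  \<open>y\<close> at \<open>i\<close> is ignored.\<close>

definition insert_coord :: "'n \<Rightarrow> real \<Rightarrow> ('n \<Rightarrow> real) \<Rightarrow> real^'n" where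
  "insert_coord i t y = (\<chi> k. if k = i then t else y k)"

lemma measurable_insert_coord [measurable]:
  "(\<lambda>(y, t). insert_coord i t y) \<in>
     (\<Pi>\<^sub>M k\<in>UNIV - {i::'n::finite}. lborel) \<Otimes>\<^sub>M lborel \<rightarrow>\<^sub>M borel"
proof (subst borel_measurable_euclidean_space, intro ballI)
  fix b :: "real^'n" assume "b \<in> Basis"
  then obtain k where k: "b = axis k 1"
    by (auto simp: Basis_vec_def)
  show "(\<lambda>x. (case x of (y, t) \<Rightarrow> insert_coord i t y) \<bullet> b) \<in>
      borel_measurable ((\<Pi>\<^sub>M k\<in>UNIV - {i}. lborel) \<Otimes>\<^sub>M lborel)"
    by (cases "k = i") (simp_all add: k insert_coord_def inner_axis case_prod_beta)
qed

text \<open>Lebesgue measure is determined by its values on boxes, and the preimage of a box is a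
  product of intervals. In dimension one the index set is empty and the product measure is a unit
  point mass.\<close>

lemma lborel_insert_coord:
  fixes i :: "'n::finite"
  shows "distr ((\<Pi>\<^sub>M k\<in>UNIV - {i}. lborel) \<Otimes>\<^sub>M lborel) borel (\<lambda>(y, t). insert_coord i t y)
         = (lborel :: (real^'n) measure)"
proof (rule lborel_eqI[symmetric])
  interpret product_sigma_finite "\<lambda>k::'n. lborel :: real measure" ..
  fix l u :: "real^'n"
  assume *: "\<And>b. b \<in> Basis \<Longrightarrow> l \<bullet> b \<le> u \<bullet> b"
  have le: "l $ k \<le> u $ k" for k
    using *[of "axis k 1"] by (auto simp: Basis_vec_def inner_axis)
  have "emeasure (distr ((\<Pi>\<^sub>M k\<in>UNIV - {i}. lborel) \<Otimes>\<^sub>M lborel) borel (\<lambda>(y, t). insert_coord i t y)) (box l u)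
    = emeasure ((\<Pi>\<^sub>M k\<in>UNIV - {i}. lborel) \<Otimes>\<^sub>M lborel)
        ((\<Pi>\<^sub>E k\<in>UNIV - {i}. {l $ k<..<u $ k}) \<times> {l $ i<..<u $ i})"
    by (subst emeasure_distr)
      (auto intro!: arg_cong2[where f=emeasure] simp: mem_box_cart insert_coord_def space_pair_measure space_PiM
          PiE_def extensional_def Pi_iff measurable_insert_coord[unfolded insert_coord_def] split: if_splits)
  also have "\<dots> = (\<Prod>k\<in>UNIV - {i}. ennreal (u $ k - l $ k)) * ennreal (u $ i - l $ i)"
    using le by (subst lborel.emeasure_pair_measure_Times) (auto simp: emeasure_PiM intro!: sets_PiM_I_finite)
  also have "\<dots> = (\<Prod>k\<in>UNIV. ennreal (u $ k - l $ k))"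
    by (simp add: prod.remove[of UNIV i] mult.commute)
  also have "\<dots> = ennreal (\<Prod>k\<in>UNIV. u $ k - l $ k)"
    using le by (intro prod_ennreal) simp
  also have "(\<Prod>k\<in>UNIV. u $ k - l $ k) = (\<Prod>b\<in>Basis. (u - l) \<bullet> b)"
    by (simp add: Basis_vec_def prod.UNION_disjoint axis_eq_axis inner_axis)
  finally show "emeasure (distr ((\<Pi>\<^sub>M k\<in>UNIV - {i}. lborel) \<Otimes>\<^sub>M lborel) borel (\<lambda>(y, t). insert_coord i t y)) (box l u)
    = ennreal (\<Prod>b\<in>Basis. (u - l) \<bullet> b)" .
qed simp

text \<open>Fubini's theorem, transported through \<open>lborel_insert_coord\<close>.\<close>

lemma
  fixes F :: "real^'n \<Rightarrow> real" and i :: 'n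
  assumes F: "integrable lborel F"
  shows integrable_slice: "AE y in (\<Pi>\<^sub>M k\<in>UNIV - {i}. lborel). integrable lborel (\<lambda>t. F (insert_coord i t y))"
    and integral_slice: "(\<integral>y. (LBINT t. F (insert_coord i t y)) \<partial>(\<Pi>\<^sub>M k\<in>UNIV - {i}. lborel)) = integral\<^sup>L lborel F"
proof -
  interpret product_sigma_finite "\<lambda>k::'n. lborel :: real measure" ..
  interpret M: sigma_finite_measure "\<Pi>\<^sub>M k\<in>UNIV - {i}. (lborel :: real measure)"
    by (rule sigma_finite) simp
  interpret pair_sigma_finite "\<Pi>\<^sub>M k\<in>UNIV - {i}. (lborel :: real measure)" "lborel :: real measure" ..
  have [measurable]: "F \<in> borel_measurable borel"
    using borel_measurable_integrable[OF F] by simp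
  have "integrable ((\<Pi>\<^sub>M k\<in>UNIV - {i}. lborel) \<Otimes>\<^sub>M lborel) (\<lambda>(y, t). F (insert_coord i t y))"
    using F unfolding lborel_insert_coord[of i, symmetric]
    by (subst (asm) integrable_distr_eq) (simp_all add: case_prod_beta')
  note int = this
  show "AE y in (\<Pi>\<^sub>M k\<in>UNIV - {i}. lborel). integrable lborel (\<lambda>t. F (insert_coord i t y))"
    using AE_integrable_fst[OF int] .
  show "(\<integral>y. (LBINT t. F (insert_coord i t y)) \<partial>(\<Pi>\<^sub>M k\<in>UNIV - {i}. lborel)) = integral\<^sup>L lborel F"
    unfolding integral_fst[OF int] lborel_insert_coord[of i, symmetric]
    by (subst integral_distr) (simp_all add: case_prod_beta')
qed

text \<open>Integrability on a slice may be presupposed, because almost every slice has it.\<close>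

lemma integral_eq_0_of_slices:
  fixes F :: "real^'n \<Rightarrow> real" and i :: 'n
  assumes F: "integrable lborel F"
    and "AE y in (\<Pi>\<^sub>M k\<in>UNIV - {i}. lborel).
           integrable lborel (\<lambda>t. F (insert_coord i t y)) \<longrightarrow> (LBINT t. F (insert_coord i t y)) = 0"
  shows "integral\<^sup>L lborel F = 0"
proof -
  have "AE y in (\<Pi>\<^sub>M k\<in>UNIV - {i}. lborel). (LBINT t. F (insert_coord i t y)) = 0"
    using integrable_slice[OF F, of i] assms(2) by eventually_elim auto
  thus ?thesis
    unfolding integral_slice[OF F, of i, symmetric] by (rule integral_eq_zero_AE)
qed

section \<open>Matrices and the Gaussian score\<close>

lemma matrix_inv_eqI:
  fixes A B :: "real^'n^'n"
  assumes "A ** B = mat 1"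
  shows "matrix_inv A = B"
proof -
  have "B ** A = mat 1"
    using assms by (simp add: matrix_left_right_inverse)
  with assms have "\<exists>A'. A ** A' = mat 1 \<and> A' ** A = mat 1"
    by blast
  \<comment> \<open>\<open>matrix_inv\<close> is a choice, so its defining property has to be
    extracted from the existence of a two-sided inverse.\<close>
  hence "A ** matrix_inv A = mat 1 \<and> matrix_inv A ** A = mat 1"
    unfolding matrix_inv_def by (rule someI_ex)
  hence "B = B ** (A ** matrix_inv A)"
    by simp
  also have "\<dots> = matrix_inv A"
    using \<open>B ** A = mat 1\<close> by (simp add: matrix_mul_assoc)
  finally show ?thesis ..
qed

lemma det_scaleR: "det (c *\<^sub>R (A :: real^'n^'n)) = c ^ CARD('n) * det A"
proof -
  have "c *\<^sub>R A = (\<chi> i. c *s A $ i)"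
    by (simp add: vec_eq_iff)
  thus ?thesis
    using det_rows_mul[of "\<lambda>_. c" "\<lambda>i. A $ i"] by simp
qed

lemma det_nz_if_definite:
  fixes A :: "real^'n^'n"
  assumes "\<And>x. x \<noteq> 0 \<Longrightarrow> x \<bullet> (A *v x) \<noteq> 0"
  shows "det A \<noteq> 0"
proof -
  have "inj ((*v) A)"
    unfolding matrix_left_invertible_injective[symmetric] matrix_left_invertible_ker
    using assms by force
  thus ?thesis
    using det_nz_iff_inj[of "(*v) A"] by (simp add: matrix_vector_mul_linear)
qed

lemma matrix_inv_right:
  fixes A :: "real^'n^'n"
  assumes "det A \<noteq> 0"
  shows "A ** matrix_inv A = mat 1"
  using assms matrix_inv_eqI unfolding invertible_det_nz[symmetric] invertible_def by metis

lemma matrix_inv_left: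
  fixes A :: "real^'n^'n"
  assumes "det A \<noteq> 0"
  shows "matrix_inv A ** A = mat 1"
  using matrix_inv_right[OF assms] by (simp add: matrix_left_right_inverse)

lemma matrix_inv_scaleR:
  fixes A :: "real^'n^'n"
  assumes "det A \<noteq> 0" "c \<noteq> 0"
  shows "matrix_inv (c *\<^sub>R A) = (1 / c) *\<^sub>R matrix_inv A"
  using assms by (intro matrix_inv_eqI)
    (simp add: matrix_inv_right scalar_matrix_assoc matrix_scalar_ac)

lemma continuous_on_det:
  fixes M :: "'a::topological_space \<Rightarrow> real^'n^'n"
  assumes "\<And>i j. continuous_on X (\<lambda>t. M t $ i $ j)"
  shows "continuous_on X (\<lambda>t. det (M t))"
  unfolding det_def by (intro continuous_intros assms)

lemma pos_def_det_nz: "pos_def A \<Longrightarrow> det A \<noteq> 0"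
  by (intro det_nz_if_definite) (auto simp: pos_def_def)

text \<open>The segment from the identity to \<open>A\<close> stays inside the invertible matrices.\<close>

lemma pos_def_det_pos:
  fixes A :: "real^'n^'n"
  assumes A: "pos_def A"
  shows "0 < det A"
proof -
  define B where "B t = (1 - t) *\<^sub>R mat 1 + t *\<^sub>R A" for t
  have nz: "det (B t) \<noteq> 0" if "t \<in> {0..1}" for t
  proof (rule pos_def_det_nz, unfold pos_def_def, intro allI impI)
    fix x :: "real^'n" assume "x \<noteq> 0"
    hence *: "0 < x \<bullet> x" "0 < x \<bullet> (A *v x)"
      using A by (auto simp: pos_def_def)
    have "x \<bullet> (B t *v x) = (1 - t) * (x \<bullet> x) + t * (x \<bullet> (A *v x))"
      by (simp add: B_def matrix_vector_mult_add_rdistrib scaleR_matrix_vector_assoc[symmetric] inner_add_right)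
    also have "0 < \<dots>"
      using * that by (cases "t = 0") (auto intro!: add_nonneg_pos)
    finally show "0 < x \<bullet> (B t *v x)" .
  qed
  have cont: "continuous_on {0..1} (\<lambda>t. det (B t))"
    by (intro continuous_on_det) (auto simp: B_def intro!: continuous_intros)
  show ?thesis
  proof (rule ccontr)
    assume "\<not> 0 < det A"
    hence "\<exists>t. 0 \<le> t \<and> t \<le> 1 \<and> det (B t) = 0"
      by (intro IVT2' cont) (auto simp: B_def)
    thus False
      using nz by auto
  qed
qed

lemma transpose_matrix_inv:
  fixes A :: "real^'n^'n"
  assumes "transpose A = A" "det A \<noteq> 0"
  shows "transpose (matrix_inv A) = matrix_inv A"
proof -
  have "A ** transpose (matrix_inv A) = transpose (matrix_inv A ** A)"
    by (simp add: matrix_transpose_mul assms(1))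
  thus ?thesis
    using matrix_inv_eqI[of A "transpose (matrix_inv A)"] assms(2) by (simp add: matrix_inv_left transpose_mat)
qed

text \<open>Substituting \<open>x = A *v y\<close> turns the quadratic form of the inverse at
  \<open>x\<close> into that of \<open>A\<close> at \<open>y\<close>.\<close>

lemma pos_def_matrix_inv:
  fixes A :: "real^'n^'n"
  assumes "pos_def A"
  shows "pos_def (matrix_inv A)"
  unfolding pos_def_def
proof (intro allI impI)
  fix x :: "real^'n" assume "x \<noteq> 0"
  define y where "y = matrix_inv A *v x"
  have x: "x = A *v y"
    using pos_def_det_nz[OF assms] by (simp add: y_def matrix_vector_mul_assoc matrix_inv_right)
  hence "y \<noteq> 0"
    using \<open>x \<noteq> 0\<close> by auto
  hence "0 < y \<bullet> (A *v y)"
    using assms by (auto simp: pos_def_def)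
  thus "0 < x \<bullet> (matrix_inv A *v x)"
    by (simp add: x[symmetric] y_def[symmetric] inner_commute)
qed

lemma pos_def_diagonal_pos:
  fixes A :: "real^'n^'n"
  assumes "pos_def A"
  shows "0 < A $ i $ i"
proof -
  have "axis i 1 \<noteq> (0 :: real^'n)"
    by (simp add: axis_eq_0_iff)
  hence "0 < axis i 1 \<bullet> (A *v axis i 1)"
    using assms by (auto simp: pos_def_def)
  thus ?thesis
    by (simp add: matrix_vector_mult_basis inner_axis' column_def)
qed

section \<open>Derivatives of determinant and inverse along a line of matrices\<close>

text \<open>In the Leibniz formula each term of the derivative drops one factor of the identity
  matrix. A permutation other than the identity moves at least two indices, so an off-diagonal zero
  survives among the other factors.\<close>

lemma det_identity_plus_has_derivative:
  fixes A :: "real^'n^'n"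
  shows "((\<lambda>t. det (mat 1 + t *\<^sub>R A)) has_real_derivative trace A) (at 0)"
proof -
  let ?P = "{p. p permutes (UNIV :: 'n set)}"
  define D where "D p = (\<Sum>i\<in>UNIV. A $ i $ p i * (\<Prod>j\<in>UNIV - {i}. (mat 1 :: real^'n^'n) $ j $ p j))" for p
  have "((\<lambda>t. det (mat 1 + t *\<^sub>R A)) has_real_derivative (\<Sum>p\<in>?P. of_int (sign p) * D p)) (at 0)"
    unfolding det_def
  proof (intro DERIV_sum DERIV_cmult)
    fix p
    have "((\<lambda>t. \<Prod>i\<in>UNIV. (mat 1 + t *\<^sub>R A) $ i $ p i) has_derivative
       (\<lambda>y. \<Sum>i\<in>UNIV. (y * A $ i $ p i) * (\<Prod>j\<in>UNIV - {i}. (mat 1 + 0 *\<^sub>R A) $ j $ p j))) (at 0)"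
      by (rule has_derivative_prod) (auto intro!: derivative_eq_intros)
    thus "((\<lambda>t. \<Prod>i\<in>UNIV. (mat 1 + t *\<^sub>R A) $ i $ p i) has_real_derivative D p) (at 0)"
      unfolding has_field_derivative_def
      by (rule has_derivative_eq_rhs) (simp add: D_def sum_distrib_left sum_distrib_right mult_ac fun_eq_iff)
  qed
  also have "(\<Sum>p\<in>?P. of_int (sign p) * D p) = (\<Sum>p\<in>?P. if p = id then trace A else 0)"
  proof (intro sum.cong refl)
    fix p assume "p \<in> ?P"
    hence p: "p permutes (UNIV :: 'n set)" by simp
    show "of_int (sign p) * D p = (if p = id then trace A else 0)"
    proof (cases "p = id")
      case True
      thus ?thesis
        by (simp add: D_def trace_def mat_def sign_id)
    next
      case False
      then obtain k where k: "p k \<noteq> k" by fastforce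
      have "p (p k) \<noteq> p k"
        using k permutes_inj[OF p] by (auto dest: injD)
      have "A $ i $ p i * (\<Prod>j\<in>UNIV - {i}. (mat 1 :: real^'n^'n) $ j $ p j) = 0" for i
      proof (cases "i = k")
        case True
        \<comment> \<open>The dropped index is \<open>k\<close> itself, so the second moved index
          \<open>p k\<close> supplies the zero.\<close>
        thus ?thesis unfolding mult_eq_0_iff using k \<open>p (p k) \<noteq> p k\<close> by (intro disjI2 prod_zero) (auto simp: mat_def intro!: bexI[of _ "p k"])
      next
        case False
        thus ?thesis unfolding mult_eq_0_iff using k by (intro disjI2 prod_zero) (auto simp: mat_def intro!: bexI[of _ k])
      qed
      hence "D p = 0"
        unfolding D_def by (rule sum.neutral[rule_format])
      thus ?thesis using False by simp
    qed
  qed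
  also have "\<dots> = trace A"
    by (simp add: sum.delta permutes_id finite_permutations)
  finally show ?thesis .
qed

text \<open>Jacobi's formula, reduced to the identity matrix by factoring out
  \<open>A\<close>.\<close>

lemma det_has_derivative_line:
  fixes A H :: "real^'n^'n"
  assumes "det A \<noteq> 0"
  shows "((\<lambda>t. det (A + t *\<^sub>R H)) has_real_derivative det A * trace (matrix_inv A ** H)) (at 0)"
proof -
  have "A + t *\<^sub>R H = A ** (mat 1 + t *\<^sub>R (matrix_inv A ** H))" for t
    using assms by (simp add: matrix_add_ldistrib matrix_scalar_ac scalar_matrix_assoc[symmetric] matrix_mul_assoc matrix_inv_right)
  hence "(\<lambda>t. det (A + t *\<^sub>R H)) = (\<lambda>t. det A * det (mat 1 + t *\<^sub>R (matrix_inv A ** H)))"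
    by (simp add: det_mul)
  thus ?thesis
    using DERIV_cmult[OF det_identity_plus_has_derivative] by simp
qed

text \<open>Cramer's rule writes the solution as a quotient of determinants, which are continuous in
  \<open>t\<close>.\<close>

lemma continuous_matrix_inv_line:
  fixes A H :: "real^'n^'n" and x :: "real^'n"
  assumes "det A \<noteq> 0"
  shows "((\<lambda>t. matrix_inv (A + t *\<^sub>R H) *v x) \<longlongrightarrow> matrix_inv A *v x) (at 0)"
    and "eventually (\<lambda>t. det (A + t *\<^sub>R H) \<noteq> 0) (at 0)"
proof -
  define C where "C k t = det (\<chi> i j. if j = k then x $ i else (A + t *\<^sub>R H) $ i $ j)" for k t
  have C: "isCont (C k) 0" for k
  proof -
    have "continuous_on UNIV (C k)"
      unfolding C_def
    proof (intro continuous_on_det)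
      show "continuous_on UNIV (\<lambda>t. (\<chi> i j. if j = k then x $ i else (A + t *\<^sub>R H) $ i $ j) $ i $ j)" for i j
        by (cases "j = k") (auto intro!: continuous_intros)
    qed
    thus ?thesis by (simp add: continuous_on_eq_continuous_at)
  qed
  have "continuous_on UNIV (\<lambda>t. det (A + t *\<^sub>R H))"
    by (intro continuous_on_det) (auto intro!: continuous_intros)
  hence D: "isCont (\<lambda>t. det (A + t *\<^sub>R H)) 0"
    by (simp add: continuous_on_eq_continuous_at)
  hence D': "((\<lambda>t. det (A + t *\<^sub>R H)) \<longlongrightarrow> det A) (at 0)"
    by (simp add: isCont_def)
  show ev: "eventually (\<lambda>t. det (A + t *\<^sub>R H) \<noteq> 0) (at 0)"
    using D' assms by (rule tendsto_imp_eventually_ne)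
  have eq: "matrix_inv (A + t *\<^sub>R H) *v x = (\<chi> k. C k t / det (A + t *\<^sub>R H))" if "det (A + t *\<^sub>R H) \<noteq> 0" for t
    unfolding C_def cramer[OF that, symmetric]
    by (simp add: matrix_vector_mul_assoc matrix_inv_right[OF that])
  have "((\<lambda>t. \<chi> k. C k t / det (A + t *\<^sub>R H)) \<longlongrightarrow> (\<chi> k. C k 0 / det A)) (at 0)"
    using C assms by (intro tendsto_vec_lambda tendsto_divide D') (auto simp: isCont_def)
  moreover have "eventually (\<lambda>t. (\<chi> k. C k t / det (A + t *\<^sub>R H)) = matrix_inv (A + t *\<^sub>R H) *v x) (at 0)"
    using ev by eventually_elim (simp add: eq)
  ultimately have "((\<lambda>t. matrix_inv (A + t *\<^sub>R H) *v x) \<longlongrightarrow> (\<chi> k. C k 0 / det A)) (at 0)"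
    by (rule Lim_transform_eventually)
  moreover have "(\<chi> k. C k 0 / det A) = matrix_inv A *v x"
    using eq[of 0] assms by simp
  ultimately show "((\<lambda>t. matrix_inv (A + t *\<^sub>R H) *v x) \<longlongrightarrow> matrix_inv A *v x) (at 0)"
    by simp
qed

text \<open>The resolvent identity
  \<open>y t = y 0 - t *\<^sub>R (matrix_inv A *v (H *v y t))\<close> is exact, so the difference
  quotient is an explicit expression in \<open>y t\<close>, and continuity of \<open>y\<close> at 0
  gives the limit.\<close>

lemma matrix_inv_quadratic_has_derivative:
  fixes A H :: "real^'n^'n" and x :: "real^'n"
  assumes "det A \<noteq> 0"
  shows "((\<lambda>t. x \<bullet> (matrix_inv (A + t *\<^sub>R H) *v x)) has_real_derivative
            - (x \<bullet> (matrix_inv A *v (H *v (matrix_inv A *v x))))) (at 0)"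
proof -
  define y where "y t = matrix_inv (A + t *\<^sub>R H) *v x" for t
  have "((\<lambda>t. - (x \<bullet> (matrix_inv A *v (H *v y t)))) \<longlongrightarrow> - (x \<bullet> (matrix_inv A *v (H *v y 0)))) (at 0)"
    using continuous_matrix_inv_line(1)[OF assms, of H x]
    by (intro tendsto_intros tendsto_inner
        bounded_linear.tendsto[OF matrix_vector_mul_bounded_linear]) (simp add: y_def)
  moreover have "eventually (\<lambda>t. - (x \<bullet> (matrix_inv A *v (H *v y t))) = (x \<bullet> y t - x \<bullet> y 0) / (t - 0)) (at 0)"
    using continuous_matrix_inv_line(2)[OF assms, of H] eventually_neq_at_within[of 0]
  proof eventually_elim
    case (elim t)
    have "A *v y t + t *\<^sub>R (H *v y t) = (A + t *\<^sub>R H) *v y t"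
      by (simp add: matrix_vector_mult_add_rdistrib scaleR_matrix_vector_assoc)
    also have "\<dots> = x"
      by (simp add: y_def matrix_vector_mul_assoc matrix_inv_right[OF elim(1)])
    finally have *: "A *v y t = x - t *\<^sub>R (H *v y t)"
      by (simp add: algebra_simps)
    have "y t = matrix_inv A *v (A *v y t)"
      by (simp add: matrix_vector_mul_assoc matrix_inv_left[OF assms])
    also have "\<dots> = y 0 - t *\<^sub>R (matrix_inv A *v (H *v y t))"
      unfolding * by (simp add: y_def matrix_vector_mult_diff_distrib matrix_vector_mult_scaleR)
    finally have "y t = y 0 - t *\<^sub>R (matrix_inv A *v (H *v y t))" .
    hence "x \<bullet> y t = x \<bullet> (y 0 - t *\<^sub>R (matrix_inv A *v (H *v y t)))"
      by simp
    thus ?case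
      using elim(2) by (simp add: inner_diff_right field_simps)
  qed
  ultimately have "((\<lambda>t. (x \<bullet> y t - x \<bullet> y 0) / (t - 0)) \<longlongrightarrow> - (x \<bullet> (matrix_inv A *v (H *v y 0)))) (at 0)"
    by (rule Lim_transform_eventually)
  thus ?thesis
    by (simp add: has_field_derivative_iff y_def)
qed

section \<open>The Gaussian density and its covariance score\<close>

text \<open>The gradient in \<open>S\<close> of the log density with covariance
  \<open>c *\<^sub>R S\<close>, at the centred point \<open>x\<close>. For symmetric
  \<open>S\<close> and \<open>c = 1\<close> it is half of
  \<open>S\<inverse> (x x\<^sup>T - S) S\<inverse>\<close>.\<close>

definition gauss_score :: "real^'n^'n \<Rightarrow> real \<Rightarrow> real^'n \<Rightarrow> real^'n^'n" where
  "gauss_score S c x = (1 / 2) *\<^sub>R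
     ((1 / c) *\<^sub>R outer_prod (matrix_inv S *v x) (matrix_inv S *v x) - matrix_inv S)"

text \<open>There is no sign condition on \<open>c\<close>, so that the mixture density can be
  rewritten at every value of \<open>v w\<close>. At \<open>c = 0\<close> both sides are divisions
  by zero, hence 0.\<close>

lemma gauss_density_scaleR:
  fixes S :: "real^'n^'n"
  assumes "det S \<noteq> 0"
  shows "gauss_density m (c *\<^sub>R S) z =
    exp (- (1 / (2 * c)) * ((z - m) \<bullet> (matrix_inv S *v (z - m)))) / sqrt ((2 * pi) ^ CARD('n) * (c ^ CARD('n) * det S))"
proof (cases "c = 0")
  case True
  thus ?thesis
    using det_scaleR[of 0 S] by (simp add: gauss_density_def)
next
  case False
  thus ?thesis
    using assms by (simp add: gauss_density_def matrix_inv_scaleR det_scaleR scaleR_matrix_vector_assoc[symmetric])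
qed

lemma gauss_density_pos:
  fixes S :: "real^'n^'n"
  assumes "pos_def S" "0 < c"
  shows "0 < gauss_density m (c *\<^sub>R S) z"
  using assms pos_def_det_pos[OF assms(1)] by (subst gauss_density_scaleR) auto

text \<open>Along \<open>S + t *\<^sub>R H\<close> the quadratic form has derivative
  \<open>- (a \<bullet> (H *v a))\<close> and the determinant follows Jacobi's formula. The quotient
  rule reproduces the density as a factor, and \<open>a \<bullet> (H *v a)\<close> is the trace of
  \<open>outer_prod a a ** H\<close>.\<close>

lemma gauss_density_has_sym_gradient:
  fixes S :: "real^'n^'n"
  assumes sym: "transpose S = S" and pos: "pos_def S" and c: "0 < c"
  shows "has_sym_gradient (\<lambda>S. gauss_density m (c *\<^sub>R S) z)
           (gauss_density m (c *\<^sub>R S) z *\<^sub>R gauss_score S c (z - m)) S"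
  unfolding has_sym_gradient_def
proof (intro conjI allI impI)
  define x where "x = z - m"
  define a where "a = matrix_inv S *v x"
  define p where "p = gauss_density m (c *\<^sub>R S) z"
  have det: "0 < det S" and nz: "det S \<noteq> 0"
    using pos_def_det_pos[OF pos] by auto
  have sym': "transpose (matrix_inv S) = matrix_inv S"
    by (rule transpose_matrix_inv[OF sym nz])
  show "transpose (gauss_density m (c *\<^sub>R S) z *\<^sub>R gauss_score S c (z - m)) =
          gauss_density m (c *\<^sub>R S) z *\<^sub>R gauss_score S c (z - m)"
    using sym' by (simp add: gauss_score_def transpose_def outer_prod_def vec_eq_iff mult.commute)
  fix H :: "real^'n^'n"
  define k where "k = (2 * pi) ^ CARD('n) * c ^ CARD('n)"
  have "0 < k" using c by (simp add: k_def)
  define Q where "Q t = x \<bullet> (matrix_inv (S + t *\<^sub>R H) *v x)" for t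
  define D where "D t = det (S + t *\<^sub>R H)" for t
  have Q: "(Q has_real_derivative - (a \<bullet> (H *v a))) (at 0)"
  proof -
    have "x \<bullet> (matrix_inv S *v (H *v a)) = a \<bullet> (H *v a)"
      by (metis a_def dot_lmul_matrix sym' transpose_matrix_vector)
    thus ?thesis
      unfolding Q_def using matrix_inv_quadratic_has_derivative[OF nz, of x H] by (simp add: a_def)
  qed
  have D: "(D has_real_derivative D 0 * trace (matrix_inv S ** H)) (at 0)"
    unfolding D_def using det_has_derivative_line[OF nz, of H] by simp
  have "0 < D 0" using det by (simp add: D_def)
  have p: "p = exp (- (1 / (2 * c)) * Q 0) / sqrt (k * D 0)"
    using c nz by (simp add: p_def gauss_density_scaleR x_def Q_def D_def k_def mult.assoc)
  have "((\<lambda>t. exp (- (1 / (2 * c)) * Q t) / sqrt (k * D t)) has_real_derivative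
          p * ((1 / (2 * c)) * (a \<bullet> (H *v a)) - (1 / 2) * trace (matrix_inv S ** H))) (at 0)"
  proof -
    have dE: "((\<lambda>t. exp (- (1 / (2 * c)) * Q t)) has_real_derivative
        exp (- (1 / (2 * c)) * Q 0) * ((1 / (2 * c)) * (a \<bullet> (H *v a)))) (at 0)"
      by (rule derivative_eq_intros Q refl | simp)+
    have dR: "((\<lambda>t. sqrt (k * D t)) has_real_derivative
        sqrt (k * D 0) * ((1 / 2) * trace (matrix_inv S ** H))) (at 0)"
    proof -
      have "((\<lambda>t. sqrt (k * D t)) has_real_derivative
          inverse (sqrt (k * D 0)) / 2 * (k * (D 0 * trace (matrix_inv S ** H)))) (at 0)"
        using \<open>0 < k\<close> \<open>0 < D 0\<close> by (intro DERIV_chain2[of sqrt] DERIV_real_sqrt DERIV_cmult D) simp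
      also have "inverse (sqrt (k * D 0)) / 2 * (k * (D 0 * trace (matrix_inv S ** H)))
          = (k * D 0) / sqrt (k * D 0) * ((1 / 2) * trace (matrix_inv S ** H))"
        by (simp add: field_simps)
      also have "(k * D 0) / sqrt (k * D 0) = sqrt (k * D 0)"
        using \<open>0 < k\<close> \<open>0 < D 0\<close> by (intro real_div_sqrt) simp
      finally show ?thesis .
    qed
    have R: "sqrt (k * D 0) \<noteq> 0"
      using \<open>0 < k\<close> \<open>0 < D 0\<close> by simp
    have frac: "(E * u * R - E * (R * v)) / (R * R) = E / R * (u - v)" if "R \<noteq> 0" for E R u v :: real
      using that by (simp add: field_simps)
    show ?thesis
      using DERIV_divide[OF dE dR R] unfolding p frac[OF R] .
  qed
  \<comment> \<open>The formula in \<open>Q\<close> and \<open>D\<close> is available where the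
    determinant is nonzero, which holds in a neighbourhood of 0, including 0 itself.\<close>
  moreover have "eventually (\<lambda>t. exp (- (1 / (2 * c)) * Q t) / sqrt (k * D t) =
      gauss_density m (c *\<^sub>R (S + t *\<^sub>R H)) z) (nhds 0)"
  proof -
    have "eventually (\<lambda>t. D t \<noteq> 0) (nhds 0)"
      using continuous_matrix_inv_line(2)[OF nz, of H] \<open>0 < D 0\<close>
      by (auto simp: D_def eventually_at_filter elim!: eventually_mono)
    thus ?thesis
      by eventually_elim (use c in \<open>simp add: gauss_density_scaleR x_def Q_def D_def k_def mult.assoc\<close>)
  qed
  ultimately have "((\<lambda>t. gauss_density m (c *\<^sub>R (S + t *\<^sub>R H)) z) has_real_derivative
      p * ((1 / (2 * c)) * (a \<bullet> (H *v a)) - (1 / 2) * trace (matrix_inv S ** H))) (at 0)"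
    by (rule DERIV_cong_ev[OF refl _ refl, THEN iffD1, rotated])
  also have "p * ((1 / (2 * c)) * (a \<bullet> (H *v a)) - (1 / 2) * trace (matrix_inv S ** H)) =
      trace ((p *\<^sub>R gauss_score S c x) ** H)"
  proof -
    have "a \<bullet> (H *v a) = (\<Sum>j\<in>UNIV. \<Sum>i\<in>UNIV. a $ j * (a $ i * H $ j $ i))"
      by (simp add: inner_vec_def matrix_vector_mult_def sum_distrib_left mult_ac)
    also have "\<dots> = trace (outer_prod a a ** H)"
      unfolding trace_def matrix_matrix_mult_def outer_prod_def
      by (subst sum.swap) (simp add: mult_ac)
    finally have *: "a \<bullet> (H *v a) = trace (outer_prod a a ** H)" .
    have "trace ((p *\<^sub>R gauss_score S c x) ** H) =
        (\<Sum>i\<in>UNIV. \<Sum>k\<in>UNIV. p * ((1 / (2 * c)) * (outer_prod a a $ i $ k * H $ k $ i) - (1 / 2) * (matrix_inv S $ i $ k * H $ k $ i)))"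
      by (simp add: trace_def matrix_matrix_mult_def gauss_score_def a_def[symmetric] field_simps)
    also have "\<dots> = p * ((1 / (2 * c)) * trace (outer_prod a a ** H) - (1 / 2) * trace (matrix_inv S ** H))"
      by (simp only: trace_def matrix_matrix_mult_def sum_distrib_left sum_subtractf right_diff_distrib vec_lambda_beta)
    finally show ?thesis using * by simp
  qed
  finally show "((\<lambda>t. gauss_density m (c *\<^sub>R (S + t *\<^sub>R H)) z) has_real_derivative
      trace ((gauss_density m (c *\<^sub>R S) z *\<^sub>R gauss_score S c (z - m)) ** H)) (at 0)"
    by (simp add: p_def x_def)
qed

section \<open>Gaussian integration by parts\<close>

lemma insert_coord_add: "insert_coord i t y + s *\<^sub>R axis i 1 = insert_coord i (t + s) y"
  by (simp add: insert_coord_def vec_eq_iff axis_def)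

lemma insert_coord_eq: "insert_coord i t y = insert_coord i 0 y + t *\<^sub>R axis i 1"
  by (simp add: insert_coord_add)

text \<open>After a shift both sides select from the same set of derivatives, so the equation holds
  even where no derivative exists.\<close>

lemma partial_deriv_insert_coord:
  "partial_deriv i f (insert_coord i t y) = deriv (\<lambda>t. f (insert_coord i t y)) t"
  using DERIV_shift[of "\<lambda>t. f (insert_coord i t y)" _ 0 t]
  by (simp add: partial_deriv_def insert_coord_add deriv_def add.commute)

lemma continuous_on_insert_coord: "continuous_on UNIV (\<lambda>t. insert_coord i t y)"
  by (subst insert_coord_eq) (intro continuous_intros)

lemma matrix_vector_insert_coord:
  fixes B :: "real^'n^'n"
  shows "(B *v (insert_coord i t y - m)) $ j = (B *v (insert_coord i 0 y - m)) $ j + t * B $ j $ i"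
proof -
  have "insert_coord i t y - m = (insert_coord i 0 y - m) + t *\<^sub>R axis i 1"
    by (subst insert_coord_eq) simp
  thus ?thesis
    by (simp only: matrix_vector_right_distrib matrix_vector_mult_scaleR matrix_vector_mult_basis)
      (simp add: column_def)
qed

lemma quadratic_form_insert_coord:
  fixes B :: "real^'n^'n"
  assumes "transpose B = B"
  shows "(insert_coord i t y - m) \<bullet> (B *v (insert_coord i t y - m)) =
    (insert_coord i 0 y - m) \<bullet> (B *v (insert_coord i 0 y - m))
      + 2 * t * (B *v (insert_coord i 0 y - m)) $ i + t\<^sup>2 * B $ i $ i"
proof -
  define x where "x = insert_coord i 0 y - m"
  define e where "e = (axis i 1 :: real^'n)"
  have *: "insert_coord i t y - m = x + t *\<^sub>R e"
    unfolding x_def e_def by (subst insert_coord_eq) simp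
  have e: "e \<bullet> w = w $ i" for w
    by (simp add: e_def inner_axis')
  have "x \<bullet> (B *v e) = e \<bullet> (B *v x)"
    by (metis assms dot_lmul_matrix inner_commute transpose_matrix_vector)
  moreover have "(B *v e) $ i = B $ i $ i"
    by (simp add: e_def matrix_vector_mult_basis column_def)
  ultimately show ?thesis
    unfolding * by (simp add: x_def[symmetric] matrix_vector_right_distrib matrix_vector_mult_scaleR
        inner_add_left inner_add_right e power2_eq_square algebra_simps)
qed

text \<open>On a coordinate line the exponent is a quadratic polynomial in \<open>t\<close>, whose
  derivative is affine.\<close>

lemma gauss_density_slice_derivative:
  fixes S :: "real^'n^'n"
  assumes "transpose S = S" "pos_def S" "0 < c"
  shows "((\<lambda>t. gauss_density m (c *\<^sub>R S) (insert_coord i t y)) has_real_derivative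
     - (1 / c) * (matrix_inv S *v (insert_coord i t y - m)) $ i * gauss_density m (c *\<^sub>R S) (insert_coord i t y)) (at t)"
proof -
  define B where "B = matrix_inv S"
  define x where "x = insert_coord i 0 y - m"
  define N where "N = sqrt ((2 * pi) ^ CARD('n) * (c ^ CARD('n) * det S))"
  have B: "transpose B = B"
    unfolding B_def by (rule transpose_matrix_inv[OF assms(1) pos_def_det_nz[OF assms(2)]])
  have p: "gauss_density m (c *\<^sub>R S) (insert_coord i t y) =
      exp (- (1 / (2 * c)) * (x \<bullet> (B *v x) + 2 * t * (B *v x) $ i + t\<^sup>2 * B $ i $ i)) / N" for t
    unfolding gauss_density_scaleR[OF pos_def_det_nz[OF assms(2)]] B_def[symmetric] N_def[symmetric]
    by (subst quadratic_form_insert_coord[OF B]) (simp add: x_def)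
  have a: "(B *v (insert_coord i t y - m)) $ i = (B *v x) $ i + t * B $ i $ i"
    unfolding x_def by (rule matrix_vector_insert_coord)
  have "N \<noteq> 0"
    using assms(3) pos_def_det_pos[OF assms(2)] by (simp add: N_def)
  thus ?thesis
    unfolding p B_def[symmetric] a using assms(3)
    by (auto intro!: derivative_eq_intros simp: field_simps power2_eq_square)
qed

text \<open>Multiplying by a nonconstant affine factor thus eventually does not decrease absolute
  values, which controls the boundary terms in \<open>gauss_stein\<close>.\<close>

lemma eventually_affine_ge_1:
  fixes b s :: real
  assumes "s \<noteq> 0"
  shows "eventually (\<lambda>t. 1 \<le> \<bar>b + t * s\<bar>) at_top" "eventually (\<lambda>t. 1 \<le> \<bar>b + t * s\<bar>) at_bot"
proof -
  have *: "1 \<le> \<bar>b + t * s\<bar>" if "(1 + \<bar>b\<bar>) / \<bar>s\<bar> \<le> \<bar>t\<bar>" for t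
  proof -
    have "1 + \<bar>b\<bar> \<le> \<bar>t * s\<bar>"
      using that assms by (simp add: abs_mult pos_divide_le_eq)
    thus ?thesis by linarith
  qed
  show "eventually (\<lambda>t. 1 \<le> \<bar>b + t * s\<bar>) at_top"
    using eventually_ge_at_top[of "(1 + \<bar>b\<bar>) / \<bar>s\<bar>"] by eventually_elim (rule *, simp)
  show "eventually (\<lambda>t. 1 \<le> \<bar>b + t * s\<bar>) at_bot"
    using eventually_le_at_bot[of "- ((1 + \<bar>b\<bar>) / \<bar>s\<bar>)"] by eventually_elim (rule *, linarith)
qed

text \<open>Meant for the boundary terms in \<open>gauss_score_by_parts\<close>: the affine function
  is an entry of \<open>S\<inverse>(z - m)\<close>, the quadratic one is twice a diagonal entry of
  the score. The absolute value on the left is handled by treating both signs.\<close>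

lemma eventually_affine_le_quadratic:
  fixes b c r s d l :: real
  assumes "0 < s" "0 < c"
  shows "eventually (\<lambda>t. \<bar>r + t * l\<bar> \<le> \<bar>(1 / c) * (b + t * s)\<^sup>2 - d\<bar>) at_top"
    and "eventually (\<lambda>t. \<bar>r + t * l\<bar> \<le> \<bar>(1 / c) * (b + t * s)\<^sup>2 - d\<bar>) at_bot"
proof -
  have 1: "eventually (\<lambda>t. r + t * l \<le> (1 / c) * (b + t * s)\<^sup>2 - d) at_top" for r l
    using assms by real_asymp
  have 2: "eventually (\<lambda>t. r + t * l \<le> (1 / c) * (b + t * s)\<^sup>2 - d) at_bot" for r l
    using assms by real_asymp
  show "eventually (\<lambda>t. \<bar>r + t * l\<bar> \<le> \<bar>(1 / c) * (b + t * s)\<^sup>2 - d\<bar>) at_top"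
    using 1[of r l] 1[of "- r" "- l"] by eventually_elim (simp add: abs_if)
  show "eventually (\<lambda>t. \<bar>r + t * l\<bar> \<le> \<bar>(1 / c) * (b + t * s)\<^sup>2 - d\<bar>) at_bot"
    using 2[of r l] 2[of "- r" "- l"] by eventually_elim (simp add: abs_if)
qed

text \<open>Stein's identity, to be applied to the components of \<open>grad h\<close>. On a line in
  direction \<open>i\<close> the difference of the two integrands is \<open>c\<close> times the
  almost everywhere derivative of \<open>f\<close> times the density, and \<open>int'\<close>
  supplies the function that dominates the boundary terms.\<close>

lemma gauss_stein:
  fixes S :: "real^'n^'n" and f :: "real^'n \<Rightarrow> real"
  assumes S: "transpose S = S" "pos_def S" and c: "0 < c"
    and ac: "AE y in (\<Pi>\<^sub>M k\<in>UNIV - {i}. lborel). locally_abs_cont (\<lambda>t. f (insert_coord i t y))"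
    and int: "integrable lborel (\<lambda>z. gauss_density m (c *\<^sub>R S) z * (c * partial_deriv i f z))"
    and int': "integrable lborel (\<lambda>z. gauss_density m (c *\<^sub>R S) z * ((matrix_inv S *v (z - m)) $ i * f z))"
  shows "(LBINT z. gauss_density m (c *\<^sub>R S) z * (c * partial_deriv i f z)) =
         (LBINT z. gauss_density m (c *\<^sub>R S) z * ((matrix_inv S *v (z - m)) $ i * f z))"
proof -
  define p where "p = gauss_density m (c *\<^sub>R S)"
  define a where "a z = (matrix_inv S *v (z - m)) $ i" for z
  define F where "F z = p z * (c * partial_deriv i f z) - p z * (a z * f z)" for z
  have int_p: "integrable lborel (\<lambda>z. p z * (c * partial_deriv i f z))"
    and int_a: "integrable lborel (\<lambda>z. p z * (a z * f z))"
    using int int' by (simp_all add: p_def a_def)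
  hence "integrable lborel F"
    unfolding F_def by simp
  moreover have "AE y in (\<Pi>\<^sub>M k\<in>UNIV - {i}. lborel).
      integrable lborel (\<lambda>t. F (insert_coord i t y)) \<longrightarrow> (LBINT t. F (insert_coord i t y)) = 0"
    using ac integrable_slice[OF int_a, of i]
  proof eventually_elim
    case (elim y)
    show ?case
    proof
      assume F: "integrable lborel (\<lambda>t. F (insert_coord i t y))"
      define \<phi> where "\<phi> t = f (insert_coord i t y)" for t
      define P where "P t = p (insert_coord i t y)" for t
      define A where "A t = a (insert_coord i t y)" for t
      have A: "A t = A 0 + t * matrix_inv S $ i $ i" for t
        unfolding A_def a_def by (rule matrix_vector_insert_coord)
      have slope: "0 < matrix_inv S $ i $ i"
        by (intro pos_def_diagonal_pos pos_def_matrix_inv S)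
      have P: "(P has_real_derivative - (1 / c) * A t * P t) (at t)" for t
        unfolding P_def p_def A_def a_def by (rule gauss_density_slice_derivative[OF S c])
      have cont_P: "continuous_on UNIV P"
        by (rule DERIV_continuous_on[OF has_field_derivative_at_within[OF P]])
      have cont_P': "continuous_on UNIV (\<lambda>t. - (1 / c) * A t * P t)"
        by (subst A) (intro continuous_intros cont_P)
      \<comment> \<open>The factor \<open>c\<close> cancels the \<open>1 / c\<close> produced by
        differentiating the density.\<close>
      have F_eq: "F (insert_coord i t y) = c * (deriv \<phi> t * P t + \<phi> t * (- (1 / c) * A t * P t))" for t
        using c by (simp add: F_def partial_deriv_insert_coord \<phi>_def[abs_def] P_def A_def field_simps)
      have "integrable lborel (\<lambda>t. (1 / c) * F (insert_coord i t y))"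
        using F by simp
      hence int_deriv: "integrable lborel (\<lambda>t. deriv \<phi> t * P t + \<phi> t * (- (1 / c) * A t * P t))"
        unfolding F_eq using c by simp
      have "(LBINT t. deriv \<phi> t * P t + \<phi> t * (- (1 / c) * A t * P t)) = 0"
      proof (rule integral_derivative_eq_0)
        fix s t :: real assume "s \<le> t"
        hence "abs_cont_on s t \<phi>"
          using elim(1) by (simp add: locally_abs_cont_def \<phi>_def[abs_def])
        thus "\<phi> t * P t - \<phi> s * P s = (LBINT t:{s..t}. deriv \<phi> t * P t + \<phi> t * (- (1 / c) * A t * P t))"
          using \<open>s \<le> t\<close> P cont_P' borel_measurable_integrable[OF int_deriv]
          by (intro abs_cont_on_by_parts) auto
      next
        show "integrable lborel (\<lambda>t. P t * (A t * \<phi> t))"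
          using elim(2) by (simp add: P_def A_def \<phi>_def)
        \<comment> \<open>\<open>A\<close> is affine with positive slope, so the condition is met
          near both ends of the line.\<close>
        have le: "\<bar>\<phi> t * P t\<bar> \<le> \<bar>P t * (A t * \<phi> t)\<bar>" if "1 \<le> \<bar>A 0 + t * matrix_inv S $ i $ i\<bar>" for t
          using that mult_right_mono[of 1 "\<bar>A t\<bar>" "\<bar>P t * \<phi> t\<bar>"] by (simp add: A[symmetric] abs_mult mult_ac)
        show "\<forall>\<^sub>F t in at_top. \<bar>\<phi> t * P t\<bar> \<le> \<bar>P t * (A t * \<phi> t)\<bar>"
          using eventually_affine_ge_1(1)[of "matrix_inv S $ i $ i" "A 0"] slope
          by (auto elim!: eventually_mono intro: le)
        show "\<forall>\<^sub>F t in at_bot. \<bar>\<phi> t * P t\<bar> \<le> \<bar>P t * (A t * \<phi> t)\<bar>"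
          using eventually_affine_ge_1(2)[of "matrix_inv S $ i $ i" "A 0"] slope
          by (auto elim!: eventually_mono intro: le)
      qed fact
      thus "(LBINT t. F (insert_coord i t y)) = 0"
        unfolding F_eq by simp
    qed
  qed
  ultimately have "integral\<^sup>L lborel F = 0"
    by (rule integral_eq_0_of_slices)
  thus ?thesis
    using Bochner_Integration.integral_diff[OF int_p int_a] by (simp add: F_def[abs_def] p_def a_def)
qed

lemma cont_differentiable_slice:
  assumes h: "cont_differentiable h"
  shows "((\<lambda>t. h (insert_coord j t y)) has_real_derivative grad h (insert_coord j t y) $ j) (at t)"
    and "continuous_on UNIV (\<lambda>t. grad h (insert_coord j t y) $ j)"
proof -
  have "(\<lambda>t. insert_coord j t y) differentiable (at t)"
    by (subst insert_coord_eq) simp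
  moreover have "h differentiable (at (insert_coord j t y))"
    using h by (simp add: cont_differentiable_def)
  ultimately have "(\<lambda>t. h (insert_coord j t y)) differentiable (at t)"
    using differentiable_chain_at[of "\<lambda>t. insert_coord j t y" t h] by (simp add: o_def)
  thus "((\<lambda>t. h (insert_coord j t y)) has_real_derivative grad h (insert_coord j t y) $ j) (at t)"
    by (simp add: grad_def partial_deriv_insert_coord DERIV_deriv_iff_real_differentiable)
  have "continuous_on UNIV (\<lambda>t. grad h (insert_coord j t y))"
    using h by (intro continuous_on_compose2[OF _ continuous_on_insert_coord]) (auto simp: cont_differentiable_def)
  thus "continuous_on UNIV (\<lambda>t. grad h (insert_coord j t y) $ j)"
    by (intro continuous_intros)
qed

text \<open>The lines run in direction \<open>j\<close>. Differentiating the entry \<open>i\<close>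
  of \<open>S\<inverse>(z - m)\<close> gives the constant part of the score, differentiating the
  density gives the quadratic part. \<open>int_score\<close> covers a whole column because the
  boundary term is dominated by its \<open>(j, j)\<close> entry. Since \<open>h\<close> is
  continuously differentiable, the classical fundamental theorem of calculus applies.\<close>

lemma gauss_score_by_parts:
  fixes S :: "real^'n^'n" and h :: "real^'n \<Rightarrow> real"
  assumes S: "transpose S = S" "pos_def S" and c: "0 < c"
    and h: "cont_differentiable h"
    and int_grad: "integrable lborel (\<lambda>z. gauss_density m (c *\<^sub>R S) z * ((matrix_inv S *v (z - m)) $ i * grad h z $ j))"
    and int_score: "\<And>i. integrable lborel (\<lambda>z. gauss_density m (c *\<^sub>R S) z * (h z * gauss_score S c (z - m) $ i $ j))"
  shows "(LBINT z. gauss_density m (c *\<^sub>R S) z * (h z * gauss_score S c (z - m) $ i $ j)) =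
         (1 / 2) * (LBINT z. gauss_density m (c *\<^sub>R S) z * ((matrix_inv S *v (z - m)) $ i * grad h z $ j))"
proof -
  define p where "p = gauss_density m (c *\<^sub>R S)"
  define B where "B = matrix_inv S"
  define a where "a i z = (B *v (z - m)) $ i" for i z
  \<comment> \<open>The factor 2 clears the one half in the score, so that \<open>F\<close>
    restricts to the derivative of \<open>\<phi>\<close> on each line.\<close>
  define F where "F z = p z * (a i z * grad h z $ j) - 2 * (p z * (h z * gauss_score S c (z - m) $ i $ j))" for z
  have ig: "integrable lborel (\<lambda>z. p z * (a i z * grad h z $ j))"
    using int_grad by (simp add: p_def a_def B_def)
  have isc: "integrable lborel (\<lambda>z. p z * (h z * gauss_score S c (z - m) $ i $ j))" for i
    using int_score[of i] by (simp add: p_def)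
  have score: "2 * gauss_score S c (z - m) $ i $ j = (1 / c) * (a i z * a j z) - B $ i $ j" for i z
    by (simp add: gauss_score_def outer_prod_def a_def B_def)
  have "integrable lborel F"
    unfolding F_def using ig isc by simp
  moreover have "AE y in (\<Pi>\<^sub>M k\<in>UNIV - {j}. lborel).
      integrable lborel (\<lambda>t. F (insert_coord j t y)) \<longrightarrow> (LBINT t. F (insert_coord j t y)) = 0"
    using integrable_slice[OF isc[of j], of j]
  proof eventually_elim
    case (elim y)
    show ?case
    proof
      assume F: "integrable lborel (\<lambda>t. F (insert_coord j t y))"
      define \<eta> where "\<eta> t = h (insert_coord j t y)" for t
      define \<eta>' where "\<eta>' t = grad h (insert_coord j t y) $ j" for t
      define P where "P t = p (insert_coord j t y)" for t
      define A where "A i t = a i (insert_coord j t y)" for i t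
      define \<phi> where "\<phi> t = \<eta> t * (A i t * P t)" for t
      have A: "A i t = A i 0 + t * B $ i $ j" for i t
        unfolding A_def a_def by (rule matrix_vector_insert_coord)
      have slope: "0 < B $ j $ j"
        unfolding B_def by (intro pos_def_diagonal_pos pos_def_matrix_inv S)
      have dA: "(A i has_real_derivative B $ i $ j) (at t)" for i t
        by (subst A[THEN ext]) (auto intro!: derivative_eq_intros)
      have dP: "(P has_real_derivative - (1 / c) * A j t * P t) (at t)" for t
        unfolding P_def p_def A_def a_def B_def by (rule gauss_density_slice_derivative[OF S c])
      have d\<eta>: "(\<eta> has_real_derivative \<eta>' t) (at t)" for t
        unfolding \<eta>_def \<eta>'_def by (rule cont_differentiable_slice(1)[OF h])
      have cont: "continuous_on UNIV P" "continuous_on UNIV (A i)" "continuous_on UNIV \<eta>" for i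
        by (intro continuous_at_imp_continuous_on ballI;
            rule DERIV_isCont[OF dP] DERIV_isCont[OF dA] DERIV_isCont[OF d\<eta>])+
      have cont': "continuous_on UNIV \<eta>'"
        unfolding \<eta>'_def by (rule cont_differentiable_slice(2)[OF h])
      have F_eq: "F (insert_coord j t y) =
          \<eta>' t * (A i t * P t) + \<eta> t * (B $ i $ j * P t + A i t * (- (1 / c) * A j t * P t))" for t
      proof -
        have "F (insert_coord j t y) = P t * (A i t * \<eta>' t) - P t * (\<eta> t * (2 * gauss_score S c (insert_coord j t y - m) $ i $ j))"
          by (simp add: F_def P_def A_def \<eta>_def \<eta>'_def)
        also have "\<dots> = P t * (A i t * \<eta>' t) - P t * (\<eta> t * ((1 / c) * (A i t * A j t) - B $ i $ j))"
          by (simp only: score A_def)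
        finally show ?thesis
          by (simp add: algebra_simps)
      qed
      show "(LBINT t. F (insert_coord j t y)) = 0"
      proof (rule integral_derivative_eq_0)
        fix s t :: real assume "s \<le> t"
        have "(LBINT x. indicator {s..t} x *\<^sub>R F (insert_coord j x y)) = \<phi> t - \<phi> s"
          unfolding F_eq using \<open>s \<le> t\<close>
        proof (rule integral_FTC_atLeastAtMost)
          show "(\<phi> has_vector_derivative \<eta>' x * (A i x * P x) + \<eta> x * (B $ i $ j * P x + A i x * (- (1 / c) * A j x * P x)))
              (at x within {s..t})" for x
            unfolding has_real_derivative_iff_has_vector_derivative[symmetric] \<phi>_def
            by (rule has_field_derivative_at_within) (auto intro!: derivative_eq_intros dA dP d\<eta>)
          show "continuous_on {s..t} (\<lambda>x. \<eta>' x * (A i x * P x) + \<eta> x * (B $ i $ j * P x + A i x * (- (1 / c) * A j x * P x)))"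
            by (intro continuous_intros continuous_on_subset[OF cont(1)] continuous_on_subset[OF cont(2)]
                continuous_on_subset[OF cont(3)] continuous_on_subset[OF cont']) auto
        qed
        thus "\<phi> t - \<phi> s = (LBINT x:{s..t}. F (insert_coord j x y))"
          by (simp add: set_lebesgue_integral_def)
      next
        show "integrable lborel (\<lambda>t. 2 * (P t * (\<eta> t * gauss_score S c (insert_coord j t y - m) $ j $ j)))"
          using elim by (simp add: P_def \<eta>_def)
        have le: "\<bar>\<phi> t\<bar> \<le> \<bar>2 * (P t * (\<eta> t * gauss_score S c (insert_coord j t y - m) $ j $ j))\<bar>"
          if "\<bar>A i 0 + t * B $ i $ j\<bar> \<le> \<bar>(1 / c) * (A j 0 + t * B $ j $ j)\<^sup>2 - B $ j $ j\<bar>" for t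
        proof -
          have "2 * (P t * (\<eta> t * gauss_score S c (insert_coord j t y - m) $ j $ j)) =
              P t * (\<eta> t * (2 * gauss_score S c (insert_coord j t y - m) $ j $ j))"
            by simp
          also have "\<dots> = P t * (\<eta> t * ((1 / c) * (A j t)\<^sup>2 - B $ j $ j))"
            by (simp only: score A_def power2_eq_square)
          finally have eq: "2 * (P t * (\<eta> t * gauss_score S c (insert_coord j t y - m) $ j $ j)) =
              P t * (\<eta> t * ((1 / c) * (A j t)\<^sup>2 - B $ j $ j))" .
          have "\<bar>A i t\<bar> \<le> \<bar>(1 / c) * (A j t)\<^sup>2 - B $ j $ j\<bar>"
            using that by (simp only: A[symmetric])
          from mult_left_mono[OF this, of "\<bar>P t * \<eta> t\<bar>"] show ?thesis
            unfolding eq \<phi>_def by (simp only: abs_mult mult_ac abs_ge_zero mult_nonneg_nonneg)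
        qed
        show "\<forall>\<^sub>F t in at_top. \<bar>\<phi> t\<bar> \<le> \<bar>2 * (P t * (\<eta> t * gauss_score S c (insert_coord j t y - m) $ j $ j))\<bar>"
          using eventually_affine_le_quadratic(1)[OF slope c] by (rule eventually_mono) (rule le)
        show "\<forall>\<^sub>F t in at_bot. \<bar>\<phi> t\<bar> \<le> \<bar>2 * (P t * (\<eta> t * gauss_score S c (insert_coord j t y - m) $ j $ j))\<bar>"
          using eventually_affine_le_quadratic(2)[OF slope c] by (rule eventually_mono) (rule le)
      qed fact
    qed
  qed
  ultimately have "integral\<^sup>L lborel F = 0"
    by (rule integral_eq_0_of_slices)
  thus ?thesis
    using Bochner_Integration.integral_diff[OF ig integrable_mult_right[OF isc[of i], of 2]]
    by (simp add: F_def[abs_def] p_def a_def B_def)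
qed

section \<open>Mixtures\<close>

lemma borel_measurable_matrix_vector_mult [measurable (raw)]:
  fixes B :: "real^'n^'m"
  assumes "f \<in> borel_measurable M"
  shows "(\<lambda>x. B *v f x) \<in> borel_measurable M"
  using assms by (rule borel_measurable_continuous_on[rotated])
    (intro linear_continuous_on matrix_vector_mul_bounded_linear)

text \<open>Pulling the scalar \<open>v w\<close> out of inverse and determinant leaves a fixed
  matrix, after which the dependence on \<open>w\<close> is visibly measurable.\<close>

lemma borel_measurable_mix_density:
  fixes S :: "real^'n^'n"
  assumes [measurable]: "u \<in> borel_measurable q" "v \<in> borel_measurable q"
    and S: "det S \<noteq> 0"
  shows "(\<lambda>(w, z). mix_density u v \<mu> \<alpha> S w z) \<in> borel_measurable (q \<Otimes>\<^sub>M lborel)"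
  unfolding mix_density_def gauss_density_scaleR[OF S] by measurable

text \<open>Reduces matrix-valued expectations to scalar integrals over the product measure, to
  which Fubini applies. Nonnegativity matters because \<open>ennreal\<close> cuts off negative
  values; it is asked almost everywhere since \<open>v\<close> is positive only almost
  everywhere.\<close>

lemma
  fixes F :: "real \<times> (real^'n) \<Rightarrow> real^'n^'n"
  assumes F: "integrable (mix_joint q u v \<mu> \<alpha> S) F"
    and meas: "(\<lambda>(w, z). mix_density u v \<mu> \<alpha> S w z) \<in> borel_measurable (q \<Otimes>\<^sub>M lborel)"
    and nonneg: "AE x in q \<Otimes>\<^sub>M lborel. 0 \<le> (case x of (w, z) \<Rightarrow> mix_density u v \<mu> \<alpha> S w z)"
  shows integrable_mix_joint_entry:
      "integrable (q \<Otimes>\<^sub>M lborel) (\<lambda>(w, z). mix_density u v \<mu> \<alpha> S w z * F (w, z) $ i $ j)"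
    and integral_mix_joint_entry:
      "(\<integral>x. F x \<partial>mix_joint q u v \<mu> \<alpha> S) $ i $ j =
       (\<integral>(w, z). mix_density u v \<mu> \<alpha> S w z * F (w, z) $ i $ j \<partial>(q \<Otimes>\<^sub>M lborel))"
proof -
  have bl: "bounded_linear (\<lambda>A :: real^'n^'n. A $ i $ j)"
    by (intro bounded_linear_compose[OF bounded_linear_vec_nth bounded_linear_vec_nth])
  have joint: "mix_joint q u v \<mu> \<alpha> S =
      density (q \<Otimes>\<^sub>M lborel) (\<lambda>x. ennreal (case x of (w, z) \<Rightarrow> mix_density u v \<mu> \<alpha> S w z))"
    by (simp add: mix_joint_def case_prod_beta')
  have int: "integrable (mix_joint q u v \<mu> \<alpha> S) (\<lambda>x. F x $ i $ j)"
    by (rule integrable_bounded_linear[OF bl F])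
  have F_meas: "(\<lambda>x. F x $ i $ j) \<in> borel_measurable (q \<Otimes>\<^sub>M lborel)"
    using borel_measurable_integrable[OF int] by (simp add: joint)
  show "integrable (q \<Otimes>\<^sub>M lborel) (\<lambda>(w, z). mix_density u v \<mu> \<alpha> S w z * F (w, z) $ i $ j)"
    using int integrable_density[OF F_meas meas nonneg] by (simp add: joint case_prod_beta')
  show "(\<integral>x. F x \<partial>mix_joint q u v \<mu> \<alpha> S) $ i $ j =
       (\<integral>(w, z). mix_density u v \<mu> \<alpha> S w z * F (w, z) $ i $ j \<partial>(q \<Otimes>\<^sub>M lborel))"
    using integral_bounded_linear[OF bl F] integral_density[OF F_meas meas nonneg]
    by (simp add: joint case_prod_beta')
qed

text \<open>By Fubini, a mixture identity follows from the Gaussian identity at almost every fixed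
  \<open>w\<close>.\<close>

lemma (in pair_sigma_finite) integral_eq_of_sections:
  fixes f g :: "_ \<Rightarrow> _ \<Rightarrow> real"
  assumes f: "integrable (M1 \<Otimes>\<^sub>M M2) (\<lambda>(x, y). f x y)" and g: "integrable (M1 \<Otimes>\<^sub>M M2) (\<lambda>(x, y). g x y)"
    and eq: "AE x in M1. (\<integral>y. f x y \<partial>M2) = (\<integral>y. g x y \<partial>M2)"
  shows "(\<integral>(x, y). f x y \<partial>(M1 \<Otimes>\<^sub>M M2)) = (\<integral>(x, y). g x y \<partial>(M1 \<Otimes>\<^sub>M M2))"
  unfolding integral_fst[OF f, symmetric] integral_fst[OF g, symmetric]
  using borel_measurable_integrable[OF integrable_fst[OF f]] borel_measurable_integrable[OF integrable_fst[OF g]] eq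
  by (rule integral_cong_AE)

text \<open>The hypothesis \<open>interchange\<close> carries the existence of the gradient as well
  as its value. What remains is an identity between three expectations, checked entry by
  entry.\<close>

theorem theorem7:
  fixes \<mu> \<alpha> :: "real^'n" and \<Sigma> :: "real^'n^'n"
    and q :: "real measure" and u v :: "real \<Rightarrow> real"
    and h :: "real^'n \<Rightarrow> real"
  assumes Sigma_sym: "transpose \<Sigma> = \<Sigma>"
    and Sigma_pos: "pos_def \<Sigma>"
    and q_distr: "real_distribution q"
    and u_meas: "u \<in> borel_measurable borel"
    and v_meas: "v \<in> borel_measurable borel"
    and v_pos: "AE w in q. 0 < v w"
    and h_C1: "cont_differentiable h"
    and h_ACL: "locally_ACL (grad h)"
    and wd_vh: "integrable (mix_joint q u v \<mu> \<alpha> \<Sigma>) (\<lambda>(w, z). v w * h z)"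
    and wd_h: "integrable (mix_marginal q u v \<mu> \<alpha> \<Sigma>) h"
    and wd_hess: "integrable (mix_joint q u v \<mu> \<alpha> \<Sigma>) (\<lambda>(w, z). v w *\<^sub>R hess h z)"
    and wd_grad: "integrable (mix_joint q u v \<mu> \<alpha> \<Sigma>)
      (\<lambda>(w, z). outer_prod (matrix_inv \<Sigma> *v (z - \<mu> - u w *\<^sub>R \<alpha>)) (grad h z))"
    and wd_score: "integrable (mix_joint q u v \<mu> \<alpha> \<Sigma>)
      (\<lambda>(w, z). h z *\<^sub>R (sym_gradient (\<lambda>S. mix_density u v \<mu> \<alpha> S w z) \<Sigma> /\<^sub>R
                         mix_density u v \<mu> \<alpha> \<Sigma> w z))"
    and interchange: "has_sym_gradient (\<lambda>S. \<integral>z. h z \<partial>mix_marginal q u v \<mu> \<alpha> S)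
      (\<integral>(w, z). h z *\<^sub>R (sym_gradient (\<lambda>S. mix_density u v \<mu> \<alpha> S w z) \<Sigma> /\<^sub>R
                         mix_density u v \<mu> \<alpha> \<Sigma> w z) \<partial>mix_joint q u v \<mu> \<alpha> \<Sigma>) \<Sigma>"
  shows "has_sym_gradient (\<lambda>S. \<integral>z. h z \<partial>mix_marginal q u v \<mu> \<alpha> S)
      ((1 / 2) *\<^sub>R (\<integral>(w, z). v w *\<^sub>R hess h z \<partial>mix_joint q u v \<mu> \<alpha> \<Sigma>)) \<Sigma> \<and>
    (1 / 2) *\<^sub>R (\<integral>(w, z). v w *\<^sub>R hess h z \<partial>mix_joint q u v \<mu> \<alpha> \<Sigma>) =
    (1 / 2) *\<^sub>R (\<integral>(w, z). outer_prod (matrix_inv \<Sigma> *v (z - \<mu> - u w *\<^sub>R \<alpha>)) (grad h z)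
                    \<partial>mix_joint q u v \<mu> \<alpha> \<Sigma>)"
proof -
  interpret q: real_distribution q by (rule q_distr)
  interpret pair_sigma_finite q "lborel :: (real^'n) measure" ..
  define P where "P = mix_density u v \<mu> \<alpha> \<Sigma>"
  define c where "c w z = matrix_inv \<Sigma> *v (z - \<mu> - u w *\<^sub>R \<alpha>)" for w z
  define \<sigma> where "\<sigma> w z = h z *\<^sub>R (sym_gradient (\<lambda>S. mix_density u v \<mu> \<alpha> S w z) \<Sigma> /\<^sub>R P w z)" for w z
  define IH where "IH = (\<integral>(w, z). v w *\<^sub>R hess h z \<partial>mix_joint q u v \<mu> \<alpha> \<Sigma>)"
  define IG where "IG = (\<integral>(w, z). outer_prod (c w z) (grad h z) \<partial>mix_joint q u v \<mu> \<alpha> \<Sigma>)"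
  define IS where "IS = (\<integral>(w, z). \<sigma> w z \<partial>mix_joint q u v \<mu> \<alpha> \<Sigma>)"
  note S = Sigma_sym Sigma_pos
  have [measurable]: "u \<in> borel_measurable q" "v \<in> borel_measurable q"
    using u_meas v_meas by (simp_all cong: measurable_cong_sets)
  have meas: "(\<lambda>(w, z). mix_density u v \<mu> \<alpha> \<Sigma> w z) \<in> borel_measurable (q \<Otimes>\<^sub>M lborel)"
    by (rule borel_measurable_mix_density) (use pos_def_det_nz[OF Sigma_pos] in measurable)
  have "AE x in q \<Otimes>\<^sub>M (lborel :: (real^'n) measure). 0 < v (fst x)"
  proof (rule AE_pair_measure)
    show "{x \<in> space (q \<Otimes>\<^sub>M (lborel :: (real^'n) measure)). 0 < v (fst x)} \<in> sets (q \<Otimes>\<^sub>M lborel)"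
      by measurable
    show "AE w in q. AE z in (lborel :: (real^'n) measure). 0 < v (fst (w, z))"
      using v_pos by eventually_elim simp
  qed
  hence nonneg: "AE x in q \<Otimes>\<^sub>M lborel. 0 \<le> (case x of (w, z) \<Rightarrow> mix_density u v \<mu> \<alpha> \<Sigma> w z)"
    by eventually_elim (auto simp: mix_density_def gauss_density_pos[OF Sigma_pos] less_imp_le)
  have diff: "z - \<mu> - u w *\<^sub>R \<alpha> = z - (\<mu> + u w *\<^sub>R \<alpha>)" for w z
    by simp
  have hess: "integrable (q \<Otimes>\<^sub>M lborel) (\<lambda>(w, z). P w z * (v w * hess h z $ i $ j))"
    "IH $ i $ j = (\<integral>(w, z). P w z * (v w * hess h z $ i $ j) \<partial>(q \<Otimes>\<^sub>M lborel))" for i j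
    using integrable_mix_joint_entry[OF wd_hess meas nonneg, of i j]
      integral_mix_joint_entry[OF wd_hess meas nonneg, of i j] by (simp_all add: P_def IH_def)
  have gradient: "integrable (q \<Otimes>\<^sub>M lborel) (\<lambda>(w, z). P w z * (c w z $ i * grad h z $ j))"
    "IG $ i $ j = (\<integral>(w, z). P w z * (c w z $ i * grad h z $ j) \<partial>(q \<Otimes>\<^sub>M lborel))" for i j
    using integrable_mix_joint_entry[OF wd_grad meas nonneg, of i j]
      integral_mix_joint_entry[OF wd_grad meas nonneg, of i j] by (simp_all add: P_def IG_def c_def outer_prod_def)
  have score: "integrable (q \<Otimes>\<^sub>M lborel) (\<lambda>(w, z). P w z * \<sigma> w z $ i $ j)"
    "IS $ i $ j = (\<integral>(w, z). P w z * \<sigma> w z $ i $ j \<partial>(q \<Otimes>\<^sub>M lborel))" for i j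
    using integrable_mix_joint_entry[OF wd_score meas nonneg, of i j]
      integral_mix_joint_entry[OF wd_score meas nonneg, of i j] by (simp_all add: P_def IS_def \<sigma>_def)
  \<comment> \<open>Where \<open>v w\<close> is positive the density cancels from the quotient and
    the Gaussian score remains.\<close>
  have \<sigma>_eq: "\<sigma> w z $ i $ j = h z * gauss_score \<Sigma> (v w) (z - (\<mu> + u w *\<^sub>R \<alpha>)) $ i $ j" if "0 < v w" for w z i j
  proof -
    have "sym_gradient (\<lambda>S. mix_density u v \<mu> \<alpha> S w z) \<Sigma> =
        P w z *\<^sub>R gauss_score \<Sigma> (v w) (z - (\<mu> + u w *\<^sub>R \<alpha>))"
      unfolding P_def mix_density_def by (intro sym_gradient_eqI gauss_density_has_sym_gradient S that)
    moreover have "P w z \<noteq> 0"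
      using gauss_density_pos[OF Sigma_pos that, of "\<mu> + u w *\<^sub>R \<alpha>" z] by (simp add: P_def mix_density_def)
    ultimately show ?thesis
      by (simp add: \<sigma>_def)
  qed
  have "IH $ i $ j = IG $ i $ j" for i j
    unfolding hess gradient
  proof (rule integral_eq_of_sections[OF hess(1) gradient(1)])
    \<comment> \<open>Coordinate projections are bounded linear, so absolute continuity passes from
      the gradient to its component \<open>j\<close>.\<close>
    have ac: "AE y in (\<Pi>\<^sub>M k\<in>UNIV - {i}. lborel). locally_abs_cont (\<lambda>t. grad h (insert_coord i t y) $ j)"
      using h_ACL[unfolded locally_ACL_def, rule_format, of i]
      by eventually_elim (auto simp: locally_abs_cont_def insert_coord_def
          intro: abs_cont_on_bounded_linear[OF _ bounded_linear_vec_nth])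
    show "AE w in q. (LBINT z. P w z * (v w * hess h z $ i $ j)) = (LBINT z. P w z * (c w z $ i * grad h z $ j))"
      using v_pos AE_integrable_fst[OF hess(1)[of i j]] AE_integrable_fst[OF gradient(1)[of i j]]
    proof eventually_elim
      case (elim w)
      have hess_eq: "hess h z $ i $ j = partial_deriv i (\<lambda>z. grad h z $ j) z" for z
        by (simp add: hess_def grad_def)
      show ?case
        using gauss_stein[OF S elim(1) ac, of "\<mu> + u w *\<^sub>R \<alpha>"] elim(2,3)
        by (simp add: P_def c_def mix_density_def hess_eq diff)
    qed
  qed
  hence IH_IG: "IH = IG"
    by (simp add: vec_eq_iff)
  have "IS $ i $ j = (1 / 2) * IG $ i $ j" for i j
  proof -
    \<comment> \<open>The factor one half is moved inside the integral to fit
      \<open>integral_eq_of_sections\<close>.\<close>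
    have half: "integrable (q \<Otimes>\<^sub>M lborel) (\<lambda>(w, z). (1 / 2) * (P w z * (c w z $ i * grad h z $ j)))"
      using integrable_mult_right[OF gradient(1)[of i j], of "1 / 2"] by (simp add: case_prod_beta')
    have "AE w in q. (LBINT z. P w z * \<sigma> w z $ i $ j) = (LBINT z. (1 / 2) * (P w z * (c w z $ i * grad h z $ j)))"
    proof -
      \<comment> \<open>A whole column of score entries must be integrable at the same
        \<open>w\<close>; the finitely many exceptional null sets are merged.\<close>
      have "AE w in q. \<forall>i. integrable lborel (\<lambda>z. P w z * \<sigma> w z $ i $ j)"
        using AE_integrable_fst[OF score(1)] by (simp add: AE_all_countable)
      with v_pos AE_integrable_fst[OF gradient(1)[of i j]] show ?thesis
      proof eventually_elim
        case (elim w)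
        show ?case
          using gauss_score_by_parts[OF S elim(1) h_C1, of "\<mu> + u w *\<^sub>R \<alpha>" i j] elim(2,3)
          by (simp add: P_def c_def mix_density_def diff \<sigma>_eq[OF elim(1)])
      qed
    qed
    from integral_eq_of_sections[OF score(1) half this] show ?thesis
      unfolding score gradient by (simp add: case_prod_beta')
  qed
  hence IS_IG: "IS = (1 / 2) *\<^sub>R IG"
    by (simp add: vec_eq_iff)
  show ?thesis
    using interchange
    unfolding IS_def[unfolded \<sigma>_def P_def, symmetric] IH_def[symmetric] IG_def[unfolded c_def, symmetric] IS_IG IH_IG
    by simp
qed

end
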